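(* Let $n\ge3$ and let $AX=B$, where $A\in\mathbb{R}^{n\times n}$ is a nonsingular $\{1;1\}$-quasiseparable matrix with a tangent-Givens-vector representation $\Omega_{GV}$, $B=\sum_{k=1}^M\omega_k^BS_k\in\mathbb{R}^{n\times m}$ has a sparse representation with parameter vector $\Omega_B=(\omega_1^B,\dots,\omega_M^B)$, and all entries of $X\in\mathbb{R}^{n\times m}$ are nonzero. For any quasiseparable representation $\Omega_{QS}$ of $A$, if $\Omega_{QS}\cap\Omega_B=\emptyset$ and $\Omega_{GV}\cap\Omega_B=\emptyset$ (the parameters of $A$ and of $B$ are independent), then $$\frac{\mathscr{K}_{\rm eff}(A(\Omega_{QS}),B(\Omega_B))}{3(n-2)}\le\mathscr{K}^{GV}_{|\Omega_B|}\le(n-1)\,\mathscr{K}_{\rm eff}(A(\Omega_{QS}),B(\Omega_B)).$$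
   Context: A quasiseparable representation of a $\{1;1\}$-quasiseparable matrix $A\in\mathbb{R}^{n\times n}$ is a vector of $7n-8$ real parameters $\Omega_{QS}=(\{p_i\}_{i=2}^n,\{a_i\}_{i=2}^{n-1},\{q_i\}_{i=1}^{n-1},\{d_i\}_{i=1}^n,\{g_i\}_{i=1}^{n-1},\{b_i\}_{i=2}^{n-1},\{h_i\}_{i=2}^n)$ with $A(i,i)=d_i$, $A(i,j)=p_ia_{i-1}a_{i-2}\cdots a_{j+1}q_j$ for $i>j$, and $A(i,j)=g_ib_{i+1}b_{i+2}\cdots b_{j-1}h_j$ for $i<j$ (empty products equal 1); $A$ is $\{1;1\}$-quasiseparable if and only if it has such a representation. A tangent-Givens-vector representation of $A$ is a vector of $5n-6$ real parameters $\Omega_{GV}=(\{l_i\}_{i=2}^{n-1},\{v_i\}_{i=1}^{n-1},\{d_i\}_{i=1}^n,\{w_i\}_{i=1}^{n-1},\{u_i\}_{i=2}^{n-1})$ such that, with $c_i=1/\sqrt{1+l_i^2}$, $s_i=l_i/\sqrt{1+l_i^2}$, $r_i=1/\sqrt{1+u_i^2}$, $t_i=u_i/\sqrt{1+u_i^2}$ for $i=2,\dots,n-1$ and $c_n:=r_n:=1$, one has $A(i,i)=d_i$, $A(i,j)=c_is_{i-1}\cdots s_{j+1}v_j$ for $i>j$, and $A(i,j)=w_it_{i+1}\cdots t_{j-1}r_j$ for $i<j$. Sparse representation of $B$: $B=\sum_{k=1}^M\omega_k^BS_k$, where the $S_k\in\mathbb{R}^{n\times m}$ are fixed constant matrices (typically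 with entries 0 and 1) and $\Omega_B=(\omega^B_1,\dots,\omega^B_M)$ are independent real parameters, independent of those of $A$. $|Z|$ denotes the entrywise absolute value, $\|Z\|_{\max}=\max_{i,j}|z_{ij}|$, inequalities are entrywise. Define (with $\eta>0$) $$\mathscr{K}^{GV}_{|\Omega_B|}:=\lim_{\eta\to0}\sup\left\{\frac1\eta\frac{\|\delta X\|_{\max}}{\|X\|_{\max}}: A(\Omega_{GV}+\delta\Omega_{GV})(X+\delta X)=B(\Omega_B+\delta\Omega_B),\ |\delta\Omega_{GV}|\le\eta|\Omega_{GV}|,\ |\delta\Omega_B|\le\eta|\Omega_B|\right\}.$$ Writing $A=A_L+A_D+A_U$ with $A_L$ strictly lower triangular, $A_D$ diagonal, $A_U$ strictly upper triangular, the effective condition number is $$\mathscr{K}_{\rm eff}(A(\Omega_{QS}),B(\Omega_B)):=\frac{1}{\|X\|_{\max}}\Big\|\sum_{k=1}^M|A^{-1}S_k||\omega_k^B|+|A^{-1}||A_D||X|+|A^{-1}||A_LX|+|A^{-1}A_L||X|+|A^{-1}||A_UX|+|A^{-1}A_U||X|\Big\|_{\max}.$$ *)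

theory Defs
  imports
    "HOL-Analysis.Analysis"
    "Jordan_Normal_Form.Gauss_Jordan_Elimination"
    "Jordan_Normal_Form.DL_Rank_Submatrix"
begin

(* Matrices are indexed from 0, as in Jordan_Normal_Form, whereas all parameter
   sequences are functions on nat that keep the mathematical numbering from 1;
   their values outside the stated index ranges are never used. *)

definition abs_mat :: "real mat \<Rightarrow> real mat" where
  "abs_mat Z = map_mat abs Z"

definition max_norm :: "real mat \<Rightarrow> real" where
  "max_norm Z = Max (abs ` elements_mat Z)"

(* only meaningful for nonsingular A *)
definition inv_mat :: "real mat \<Rightarrow> real mat" where
  "inv_mat A = the (mat_inverse A)"

definition lower_part :: "real mat \<Rightarrow> real mat" where
  "lower_part A = mat (dim_row A) (dim_col A) (\<lambda>(i, j). if j < i then A $$ (i, j) else 0)"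

definition diag_part :: "real mat \<Rightarrow> real mat" where
  "diag_part A = mat (dim_row A) (dim_col A) (\<lambda>(i, j). if i = j then A $$ (i, j) else 0)"

definition upper_part :: "real mat \<Rightarrow> real mat" where
  "upper_part A = mat (dim_row A) (dim_col A) (\<lambda>(i, j). if i < j then A $$ (i, j) else 0)"

(* Every submatrix lying entirely in the strictly lower (upper) triangle has rank at
   most nL (nU).  The bounds need not be attained: otherwise diagonal matrices, which
   have quasiseparable representations, would not be {1;1}-quasiseparable. *)
definition quasiseparable :: "nat \<Rightarrow> nat \<Rightarrow> nat \<Rightarrow> real mat \<Rightarrow> bool" where
  "quasiseparable nL nU n A \<longleftrightarrow> A \<in> carrier_mat n n \<and>
     (\<forall>I J. I \<subseteq> {..<n} \<and> J \<subseteq> {..<n} \<longrightarrow>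
        ((\<forall>i\<in>I. \<forall>j\<in>J. j < i) \<longrightarrow> vec_space.rank (card I) (submatrix A I J) \<le> nL) \<and>
        ((\<forall>i\<in>I. \<forall>j\<in>J. i < j) \<longrightarrow> vec_space.rank (card I) (submatrix A I J) \<le> nU))"

(* Index ranges: p, h: 2..n;  a, b: 2..n-1;  q, g: 1..n-1;  d: 1..n. *)
datatype qs_params = QS
  (qs_p: "nat \<Rightarrow> real") (qs_a: "nat \<Rightarrow> real") (qs_q: "nat \<Rightarrow> real") (qs_d: "nat \<Rightarrow> real")
  (qs_g: "nat \<Rightarrow> real") (qs_b: "nat \<Rightarrow> real") (qs_h: "nat \<Rightarrow> real")

definition qs_entry :: "qs_params \<Rightarrow> nat \<Rightarrow> nat \<Rightarrow> real" where
  "qs_entry \<Omega> i j =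
     (if i = j then qs_d \<Omega> i
      else if j < i then qs_p \<Omega> i * (\<Prod>k\<in>{j<..<i}. qs_a \<Omega> k) * qs_q \<Omega> j
      else qs_g \<Omega> i * (\<Prod>k\<in>{i<..<j}. qs_b \<Omega> k) * qs_h \<Omega> j)"

definition qs_mat :: "nat \<Rightarrow> qs_params \<Rightarrow> real mat" where
  "qs_mat n \<Omega> = mat n n (\<lambda>(i, j). qs_entry \<Omega> (Suc i) (Suc j))"

(* Index ranges: l, u: 2..n-1;  v, w: 1..n-1;  d: 1..n. *)
datatype gv_params = GV
  (gv_l: "nat \<Rightarrow> real") (gv_v: "nat \<Rightarrow> real") (gv_d: "nat \<Rightarrow> real")
  (gv_w: "nat \<Rightarrow> real") (gv_u: "nat \<Rightarrow> real")

(* Cosine and sine of the rotation with tangent x i; used for (c, s) with x = l and for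
   (r, t) with x = u.  The cosine at index n is 1 by convention. *)
definition givens_cos :: "nat \<Rightarrow> (nat \<Rightarrow> real) \<Rightarrow> nat \<Rightarrow> real" where
  "givens_cos n x i = (if i = n then 1 else 1 / sqrt (1 + (x i)\<^sup>2))"

definition givens_sin :: "(nat \<Rightarrow> real) \<Rightarrow> nat \<Rightarrow> real" where
  "givens_sin x i = x i / sqrt (1 + (x i)\<^sup>2)"

definition gv_entry :: "nat \<Rightarrow> gv_params \<Rightarrow> nat \<Rightarrow> nat \<Rightarrow> real" where
  "gv_entry n \<Omega> i j =
     (if i = j then gv_d \<Omega> i
      else if j < i then
        givens_cos n (gv_l \<Omega>) i * (\<Prod>k\<in>{j<..<i}. givens_sin (gv_l \<Omega>) k) * gv_v \<Omega> j
      else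
        gv_w \<Omega> i * (\<Prod>k\<in>{i<..<j}. givens_sin (gv_u \<Omega>) k) * givens_cos n (gv_u \<Omega>) j)"

definition gv_mat :: "nat \<Rightarrow> gv_params \<Rightarrow> real mat" where
  "gv_mat n \<Omega> = mat n n (\<lambda>(i, j). gv_entry n \<Omega> (Suc i) (Suc j))"

definition gv_add :: "gv_params \<Rightarrow> gv_params \<Rightarrow> gv_params" where
  "gv_add \<Omega> \<Delta> = GV (\<lambda>i. gv_l \<Omega> i + gv_l \<Delta> i) (\<lambda>i. gv_v \<Omega> i + gv_v \<Delta> i)
     (\<lambda>i. gv_d \<Omega> i + gv_d \<Delta> i) (\<lambda>i. gv_w \<Omega> i + gv_w \<Delta> i) (\<lambda>i. gv_u \<Omega> i + gv_u \<Delta> i)"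

(* |\<Delta>| \<le> \<eta> |\<Omega>| for the 5n - 6 actual parameters *)
definition gv_small :: "nat \<Rightarrow> real \<Rightarrow> gv_params \<Rightarrow> gv_params \<Rightarrow> bool" where
  "gv_small n \<eta> \<Omega> \<Delta> \<longleftrightarrow>
     (\<forall>i\<in>{2..n-1}. \<bar>gv_l \<Delta> i\<bar> \<le> \<eta> * \<bar>gv_l \<Omega> i\<bar> \<and> \<bar>gv_u \<Delta> i\<bar> \<le> \<eta> * \<bar>gv_u \<Omega> i\<bar>) \<and>
     (\<forall>i\<in>{1..n-1}. \<bar>gv_v \<Delta> i\<bar> \<le> \<eta> * \<bar>gv_v \<Omega> i\<bar> \<and> \<bar>gv_w \<Delta> i\<bar> \<le> \<eta> * \<bar>gv_w \<Omega> i\<bar>) \<and>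
     (\<forall>i\<in>{1..n}. \<bar>gv_d \<Delta> i\<bar> \<le> \<eta> * \<bar>gv_d \<Omega> i\<bar>)"

(* The n x m matrix \<omega> 1 * S 1 + ... + \<omega> M * S M, written entrywise because the type of
   matrices of all sizes has no sum operator. *)
definition sparse_mat ::
  "nat \<Rightarrow> nat \<Rightarrow> nat \<Rightarrow> (nat \<Rightarrow> real mat) \<Rightarrow> (nat \<Rightarrow> real) \<Rightarrow> real mat" where
  "sparse_mat n m M S \<omega> = mat n m (\<lambda>(i, j). \<Sum>k=1..M. \<omega> k * S k $$ (i, j))"

(* The parameters of A and of B are perturbed separately: this is their independence. *)
definition gv_growth ::
  "nat \<Rightarrow> nat \<Rightarrow> nat \<Rightarrow> (nat \<Rightarrow> real mat) \<Rightarrow> gv_params \<Rightarrow> (nat \<Rightarrow> real) \<Rightarrow> real mat \<Rightarrow> real \<Rightarrow> ereal" where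
  "gv_growth n m M S \<Omega> \<omega> X \<eta> =
     Sup {ereal (1 / \<eta> * (max_norm \<delta>X / max_norm X)) | \<delta>X \<delta>\<Omega> \<delta>\<omega>.
       \<delta>X \<in> carrier_mat n m \<and>
       gv_mat n (gv_add \<Omega> \<delta>\<Omega>) * (X + \<delta>X) = sparse_mat n m M S (\<lambda>k. \<omega> k + \<delta>\<omega> k) \<and>
       gv_small n \<eta> \<Omega> \<delta>\<Omega> \<and> (\<forall>k\<in>{1..M}. \<bar>\<delta>\<omega> k\<bar> \<le> \<eta> * \<bar>\<omega> k\<bar>)}"

definition gv_cond ::
  "nat \<Rightarrow> nat \<Rightarrow> nat \<Rightarrow> (nat \<Rightarrow> real mat) \<Rightarrow> gv_params \<Rightarrow> (nat \<Rightarrow> real) \<Rightarrow> real mat \<Rightarrow> ereal" where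
  "gv_cond n m M S \<Omega> \<omega> X = Lim (at_right 0) (gv_growth n m M S \<Omega> \<omega> X)"

definition eff_cond ::
  "nat \<Rightarrow> nat \<Rightarrow> nat \<Rightarrow> (nat \<Rightarrow> real mat) \<Rightarrow> real mat \<Rightarrow> (nat \<Rightarrow> real) \<Rightarrow> real mat \<Rightarrow> real" where
  "eff_cond n m M S A \<omega> X =
     1 / max_norm X * max_norm
      (sparse_mat n m M (\<lambda>k. abs_mat (inv_mat A * S k)) (\<lambda>k. \<bar>\<omega> k\<bar>)
       + abs_mat (inv_mat A) * abs_mat (diag_part A) * abs_mat X
       + abs_mat (inv_mat A) * abs_mat (lower_part A * X)
       + abs_mat (inv_mat A * lower_part A) * abs_mat X
       + abs_mat (inv_mat A) * abs_mat (upper_part A * X)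
       + abs_mat (inv_mat A * upper_part A) * abs_mat X)"

end

theory Submission
  imports Defs
begin

text \<open>
  Both condition numbers are maxima over the entries of two explicit nonnegative matrices, divided
  by \<open>max_norm X\<close>, and the two matrices are compared entry by entry.

  To first order a perturbation of the data changes the solution by
  \<open>Y (\<delta>B - \<delta>A X)\<close>, where \<open>Y\<close> is the inverse of \<open>A\<close>. In the relative
  perturbations of the parameters this is linear, so its supremum over the unit box is attained at a
  choice of signs and equals the sum of the absolute values of the coefficients; these sums form the
  matrix \<open>sensitivity\<close>. The limit defining the condition number is shown to be
  \<open>max_norm sensitivity / max_norm X\<close> in \<open>growth_tendsto\<close>. Since the supremum
  is taken before the limit, the linearisation has to hold uniformly over the box. This is
  obtained by computing limits along a filter on pairs of a size \<open>\<eta>\<close> and a direction, and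
  the derivatives are organised as logarithmic derivatives, because every off-diagonal entry of
  \<open>A\<close> is a product of functions of single parameters. The term of second order is a matrix
  times \<open>\<delta>X\<close> itself; it is absorbed on the left.

  For the comparison, fix an entry \<open>(r, c)\<close> and put
  \<open>\<alpha> i j = Y\<^sub>r\<^sub>i A\<^sub>i\<^sub>j X\<^sub>j\<^sub>c\<close>. A parameter \<open>v\<^sub>j\<close>
  contributes the sum of \<open>\<alpha>\<close> over column \<open>j\<close> below the diagonal. The tangent
  \<open>l\<^sub>k\<close> enters through the cosine of row \<open>k\<close> and through the sines of all entries
  strictly below and to the left of position \<open>(k, k)\<close>, hence contributes
  \<open>(1 - s\<^sub>k\<^sup>2)\<close> times the sum over that corner minus \<open>s\<^sub>k\<^sup>2\<close> times the sum over
  row \<open>k\<close>. The effective condition number has the row sums in place of these mixed sums.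
  The rectangle of rows \<open>\<ge> k\<close> and columns \<open>< k\<close> is the corner at \<open>k\<close> plus row
  \<open>k\<close>, and also the corner at \<open>k - 1\<close> plus column \<open>k - 1\<close>. This recurrence
  bounds the mixed sums by row and column sums (\<open>rotation_sums_le\<close>) and the row sums by column
  sums and mixed sums (\<open>row_sums_le\<close>). The upper triangle is the same problem for the
  transpose of \<open>\<alpha>\<close>. The effective condition number is built from \<open>A\<close> itself, so it has
  the same value for all quasiseparable representations.
\<close>

section \<open>Row, column and corner sums of a strictly triangular array\<close>

text \<open>
  Indices start at 0; the sums below involve only the entries of \<open>\<alpha>\<close> strictly below the
  diagonal.
\<close>

definition row_sum :: "(nat \<Rightarrow> nat \<Rightarrow> real) \<Rightarrow> nat \<Rightarrow> real" where
  "row_sum \<alpha> i = (\<Sum>j<i. \<alpha> i j)"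

definition col_sum :: "nat \<Rightarrow> (nat \<Rightarrow> nat \<Rightarrow> real) \<Rightarrow> nat \<Rightarrow> real" where
  "col_sum n \<alpha> j = (\<Sum>i\<in>{j<..<n}. \<alpha> i j)"

definition corner_sum :: "nat \<Rightarrow> (nat \<Rightarrow> nat \<Rightarrow> real) \<Rightarrow> nat \<Rightarrow> real" where
  "corner_sum n \<alpha> k = (\<Sum>i\<in>{k<..<n}. \<Sum>j<k. \<alpha> i j)"

text \<open>
  With \<open>\<sigma> k\<close> the squared sine of the \<open>k\<close>th rotation, this is the coefficient of the
  relative change of the \<open>k\<close>th tangent; see \<open>sum_chain_rate\<close>.
\<close>

definition rotation_sum :: "nat \<Rightarrow> (nat \<Rightarrow> real) \<Rightarrow> (nat \<Rightarrow> nat \<Rightarrow> real) \<Rightarrow> nat \<Rightarrow> real" where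
  "rotation_sum n \<sigma> \<alpha> k = (1 - \<sigma> k) * corner_sum n \<alpha> k - \<sigma> k * row_sum \<alpha> k"

lemma row_sum_eq:
  assumes "i < n"
  shows "row_sum \<alpha> i = (\<Sum>j<n. if j < i then \<alpha> i j else 0)"
  unfolding row_sum_def using assms by (auto intro!: sum.mono_neutral_cong_left split: if_splits)

lemma col_sum_eq:
  assumes "j < n"
  shows "col_sum n \<alpha> j = (\<Sum>i<n. if j < i then \<alpha> i j else 0)"
  unfolding col_sum_def using assms by (auto intro!: sum.mono_neutral_cong_left split: if_splits)

text \<open>
  Both sides are the sum over the rectangle of the rows below \<open>k\<close> and the columns up to
  \<open>k\<close>, once with its top row and once with its last column split off.
\<close>

lemma corner_sum_Suc:
  assumes "Suc k < n"
  shows "corner_sum n \<alpha> (Suc k) + row_sum \<alpha> (Suc k) = corner_sum n \<alpha> k + col_sum n \<alpha> k"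
proof -
  have "{k<..<n} = insert (Suc k) {Suc k<..<n}"
    using assms by auto
  then have "(\<Sum>i\<in>{k<..<n}. \<Sum>j<Suc k. \<alpha> i j) = corner_sum n \<alpha> (Suc k) + row_sum \<alpha> (Suc k)"
    by (simp add: corner_sum_def row_sum_def)
  moreover have "(\<Sum>i\<in>{k<..<n}. \<Sum>j<Suc k. \<alpha> i j) = corner_sum n \<alpha> k + col_sum n \<alpha> k"
    by (simp add: corner_sum_def col_sum_def sum.distrib)
  ultimately show ?thesis by simp
qed

lemma corner_sum_eq:
  "k < n \<Longrightarrow> corner_sum n \<alpha> k = (\<Sum>j<k. col_sum n \<alpha> j) - (\<Sum>i\<le>k. row_sum \<alpha> i)"
proof (induction k)
  case 0
  then show ?case by (simp add: corner_sum_def row_sum_def)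
next
  case (Suc k)
  with corner_sum_Suc[of k n \<alpha>] show ?case by simp
qed

text \<open>
  A corner is a signed sum of distinct row and column sums, and a rotation sum is a convex
  combination of a corner and a negated row sum.
\<close>

lemma abs_rotation_sum_le:
  assumes "k < n" "0 \<le> \<sigma> k" "\<sigma> k \<le> 1"
  shows "\<bar>rotation_sum n \<sigma> \<alpha> k\<bar> \<le> (\<Sum>i<n. \<bar>row_sum \<alpha> i\<bar>) + (\<Sum>j<n. \<bar>col_sum n \<alpha> j\<bar>)" (is "_ \<le> ?B")
proof -
  have "\<bar>corner_sum n \<alpha> k\<bar> \<le> (\<Sum>j<k. \<bar>col_sum n \<alpha> j\<bar>) + (\<Sum>i\<le>k. \<bar>row_sum \<alpha> i\<bar>)"
    unfolding corner_sum_eq[OF assms(1)]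
    by (intro order_trans[OF abs_triangle_ineq4] add_mono sum_abs)
  also have "\<dots> \<le> (\<Sum>j<n. \<bar>col_sum n \<alpha> j\<bar>) + (\<Sum>i<n. \<bar>row_sum \<alpha> i\<bar>)"
    using assms(1) by (intro add_mono sum_mono2) auto
  finally have c: "\<bar>corner_sum n \<alpha> k\<bar> \<le> ?B" by simp
  have "\<bar>row_sum \<alpha> k\<bar> \<le> (\<Sum>i<n. \<bar>row_sum \<alpha> i\<bar>)"
    using assms(1) by (intro member_le_sum) auto
  also have "\<dots> \<le> ?B" by (simp add: sum_nonneg)
  finally have r: "\<bar>row_sum \<alpha> k\<bar> \<le> ?B" .
  have "\<bar>rotation_sum n \<sigma> \<alpha> k\<bar> \<le> (1 - \<sigma> k) * \<bar>corner_sum n \<alpha> k\<bar> + \<sigma> k * \<bar>row_sum \<alpha> k\<bar>"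
    unfolding rotation_sum_def using assms by (simp add: order_trans[OF abs_triangle_ineq4] abs_mult)
  also have "\<dots> \<le> (1 - \<sigma> k) * ?B + \<sigma> k * ?B"
    using assms c r by (intro add_mono mult_left_mono) auto
  finally show ?thesis by (simp add: algebra_simps)
qed

text \<open>
  Each of the \<open>n - 2\<close> rotations costs at most one copy of all rows and columns; the factor
  \<open>n - 1\<close> pays in addition for the column sums on the left.
\<close>

lemma rotation_sums_le:
  assumes "3 \<le> n" and \<sigma>: "\<And>k. 0 \<le> \<sigma> k \<and> \<sigma> k \<le> 1"
  shows "(\<Sum>j<n. \<bar>col_sum n \<alpha> j\<bar>) + (\<Sum>k\<in>{1..<n-1}. \<bar>rotation_sum n \<sigma> \<alpha> k\<bar>)
    \<le> (real n - 1) * ((\<Sum>i<n. \<bar>row_sum \<alpha> i\<bar>) + (\<Sum>j<n. \<bar>col_sum n \<alpha> j\<bar>))" (is "?C + ?G \<le> _ * (?R + ?C)")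
proof -
  have "?G \<le> (\<Sum>k\<in>{1..<n-1}. ?R + ?C)"
    using \<sigma> by (intro sum_mono abs_rotation_sum_le) auto
  also have "\<dots> = (real n - 2) * (?R + ?C)"
    using assms(1) by (simp add: of_nat_diff)
  finally have "?C + ?G \<le> ?C + (real n - 2) * (?R + ?C)" by simp
  also have "\<dots> \<le> (real n - 1) * (?R + ?C)"
    by (simp add: algebra_simps sum_nonneg)
  finally show ?thesis .
qed

text \<open>
  The rectangle and the rotation sum are two linear equations for the corner and the row. Their
  determinant is \<open>- \<sigma> - (1 - \<sigma>) = - 1\<close>, so solving them involves no division, and for
  \<open>0 \<le> \<sigma> \<le> 1\<close> both coefficients of the rectangle lie between 0 and 1.
\<close>

lemma rotation_sum_Suc:
  assumes "Suc k < n"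
  shows "corner_sum n \<alpha> (Suc k)
      = rotation_sum n \<sigma> \<alpha> (Suc k) + \<sigma> (Suc k) * (corner_sum n \<alpha> k + col_sum n \<alpha> k)"
    and "row_sum \<alpha> (Suc k)
      = (1 - \<sigma> (Suc k)) * (corner_sum n \<alpha> k + col_sum n \<alpha> k) - rotation_sum n \<sigma> \<alpha> (Suc k)"
  unfolding corner_sum_Suc[OF assms, of \<alpha>, symmetric] rotation_sum_def by (simp_all add: algebra_simps)

text \<open>
  Iterating the first of these equations: on the way from corner to corner, the old corner and the
  new column are damped by \<open>\<sigma>\<close>, and one rotation sum is added.
\<close>

lemma abs_corner_sum_le:
  assumes \<sigma>: "\<And>k. 0 \<le> \<sigma> k \<and> \<sigma> k \<le> 1"
  shows "k < n \<Longrightarrow> \<bar>corner_sum n \<alpha> k\<bar>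
    \<le> (\<Sum>j<k. \<bar>col_sum n \<alpha> j\<bar>) + (\<Sum>i\<in>{1..k}. \<bar>rotation_sum n \<sigma> \<alpha> i\<bar>)"
proof (induction k)
  case 0
  then show ?case by (simp add: corner_sum_def)
next
  case (Suc k)
  let ?h = "corner_sum n \<alpha> k + col_sum n \<alpha> k"
  have "\<bar>\<sigma> (Suc k) * ?h\<bar> \<le> \<bar>?h\<bar>"
    using \<sigma>[of "Suc k"] by (simp add: abs_mult mult_left_le_one_le)
  then have "\<bar>corner_sum n \<alpha> (Suc k)\<bar> \<le> \<bar>rotation_sum n \<sigma> \<alpha> (Suc k)\<bar> + \<bar>?h\<bar>"
    using rotation_sum_Suc(1)[OF Suc.prems, of \<alpha> \<sigma>] by linarith
  with Suc show ?case by simp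
qed

lemma abs_row_sum_le:
  assumes \<sigma>: "\<And>k. 0 \<le> \<sigma> k \<and> \<sigma> k \<le> 1" and "i < n"
  shows "\<bar>row_sum \<alpha> i\<bar>
    \<le> (\<Sum>j<n. \<bar>col_sum n \<alpha> j\<bar>) + (\<Sum>k\<in>{1..<n-1}. \<bar>rotation_sum n \<sigma> \<alpha> k\<bar>)" (is "_ \<le> ?C + ?G")
proof (cases i)
  case 0
  then show ?thesis by (simp add: row_sum_def sum_nonneg add_nonneg_nonneg)
next
  case (Suc k)
  let ?h = "corner_sum n \<alpha> k + col_sum n \<alpha> k"
  have k: "Suc k < n" using Suc assms by simp
  have h: "\<bar>?h\<bar> \<le> (\<Sum>j<Suc k. \<bar>col_sum n \<alpha> j\<bar>) + (\<Sum>i\<in>{1..k}. \<bar>rotation_sum n \<sigma> \<alpha> i\<bar>)"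
    using abs_corner_sum_le[of \<sigma> k n \<alpha>, OF \<sigma>] k by simp
  have C: "(\<Sum>j<Suc k. \<bar>col_sum n \<alpha> j\<bar>) \<le> ?C"
    using k by (intro sum_mono2) auto
  show ?thesis
  proof (cases "Suc k = n - 1")
    case True
    \<comment> \<open>Below the last row there is no corner, so its row sum is the previous corner plus one column.\<close>
    then have "corner_sum n \<alpha> (Suc k) = 0" by (auto simp: corner_sum_def intro!: sum.neutral)
    then have "row_sum \<alpha> (Suc k) = ?h" using corner_sum_Suc[OF k, of \<alpha>] by simp
    moreover have "{1..<n-1} = {1..k}" using True by auto
    ultimately show ?thesis using h C Suc by simp
  next
    case False
    then have "(\<Sum>i\<in>{1..Suc k}. \<bar>rotation_sum n \<sigma> \<alpha> i\<bar>) \<le> ?G"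
      using k by (intro sum_mono2) auto
    moreover have "\<bar>(1 - \<sigma> (Suc k)) * ?h\<bar> \<le> \<bar>?h\<bar>"
      using \<sigma>[of "Suc k"] by (simp add: abs_mult mult_left_le_one_le)
    then have "\<bar>row_sum \<alpha> (Suc k)\<bar> \<le> \<bar>?h\<bar> + \<bar>rotation_sum n \<sigma> \<alpha> (Suc k)\<bar>"
      using rotation_sum_Suc(2)[OF k, of \<alpha> \<sigma>] by linarith
    ultimately show ?thesis using h C Suc by simp
  qed
qed

text \<open>
  The \<open>n - 1\<close> nonempty rows and the columns themselves give the factor \<open>n\<close>, which is
  at most \<open>3 (n - 2)\<close> exactly when \<open>3 \<le> n\<close>.
\<close>

lemma row_sums_le:
  assumes "3 \<le> n" and \<sigma>: "\<And>k. 0 \<le> \<sigma> k \<and> \<sigma> k \<le> 1"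
  shows "(\<Sum>i<n. \<bar>row_sum \<alpha> i\<bar>) + (\<Sum>j<n. \<bar>col_sum n \<alpha> j\<bar>)
    \<le> 3 * (real n - 2) * ((\<Sum>j<n. \<bar>col_sum n \<alpha> j\<bar>) + (\<Sum>k\<in>{1..<n-1}. \<bar>rotation_sum n \<sigma> \<alpha> k\<bar>))"
    (is "?R + ?C \<le> _ * (?C + ?G)")
proof -
  have "{..<n} = insert 0 {1..<n}" using assms(1) by auto
  then have "?R = (\<Sum>i\<in>{1..<n}. \<bar>row_sum \<alpha> i\<bar>)" by (simp add: row_sum_def)
  also have "\<dots> \<le> (\<Sum>i\<in>{1..<n}. ?C + ?G)"
    using \<sigma> by (intro sum_mono abs_row_sum_le) auto
  also have "\<dots> = (real n - 1) * (?C + ?G)" using assms(1) by (simp add: of_nat_diff)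
  finally have "?R + ?C \<le> (real n - 1) * (?C + ?G) + (?C + ?G)"
    by (simp add: sum_nonneg add_increasing2)
  also have "\<dots> = real n * (?C + ?G)" by (simp add: algebra_simps)
  also have "\<dots> \<le> 3 * (real n - 2) * (?C + ?G)"
    using assms(1) by (intro mult_right_mono add_nonneg_nonneg sum_nonneg) auto
  finally show ?thesis .
qed

text \<open>
  The logarithmic derivative of the entry \<open>cos i * sin (i-1) * ... * sin (j+1) * v j\<close>, where the
  tangents and the \<open>v j\<close> change at the relative rates \<open>\<epsilon>\<close> and \<open>\<nu>\<close>. In the last
  row the cosine is the constant 1.
\<close>

definition chain_rate :: "nat \<Rightarrow> (nat \<Rightarrow> real) \<Rightarrow> (nat \<Rightarrow> real) \<Rightarrow> (nat \<Rightarrow> real) \<Rightarrow> nat \<Rightarrow> nat \<Rightarrow> real" where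
  "chain_rate n \<sigma> \<epsilon> \<nu> i j =
     (if Suc i = n then 0 else - \<sigma> i * \<epsilon> i) + (\<Sum>k\<in>{j<..<i}. (1 - \<sigma> k) * \<epsilon> k) + \<nu> j"

text \<open>
  Collecting the coefficient of each rate: \<open>\<epsilon> k\<close> occurs with \<open>1 - \<sigma> k\<close> in the
  entries with \<open>j < k < i\<close>, which form a corner, and with \<open>- \<sigma> k\<close> in row \<open>k\<close>.
\<close>

lemma sum_chain_rate:
  "(\<Sum>i<n. \<Sum>j<i. \<alpha> i j * chain_rate n \<sigma> \<epsilon> \<nu> i j)
     = (\<Sum>j<n. \<nu> j * col_sum n \<alpha> j) + (\<Sum>k\<in>{1..<n-1}. \<epsilon> k * rotation_sum n \<sigma> \<alpha> k)"
proof -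
  have swap: "(\<Sum>i<n. \<Sum>j<i. \<alpha> i j * \<nu> j) = (\<Sum>j<n. \<nu> j * col_sum n \<alpha> j)"
    unfolding col_sum_def sum_distrib_left
    by (subst (1 2) sum.Sigma)
       (auto intro!: sum.reindex_bij_witness[of _ "\<lambda>(j, i). (i, j)" "\<lambda>(i, j). (j, i)"] simp: mult.commute)
  have corner: "(\<Sum>i<n. \<Sum>j<i. \<alpha> i j * (\<Sum>k\<in>{j<..<i}. (1 - \<sigma> k) * \<epsilon> k))
      = (\<Sum>k<n. (1 - \<sigma> k) * \<epsilon> k * corner_sum n \<alpha> k)"
    unfolding corner_sum_def sum_distrib_left
    by (simp add: sum.Sigma)
       (auto intro!: sum.reindex_bij_witness[of _ "\<lambda>(k, i, j). (i, j, k)" "\<lambda>(i, j, k). (k, i, j)"]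
          simp: mult_ac)
  have inner: "(\<Sum>k<n. (1 - \<sigma> k) * \<epsilon> k * corner_sum n \<alpha> k)
      = (\<Sum>k\<in>{1..<n-1}. (1 - \<sigma> k) * \<epsilon> k * corner_sum n \<alpha> k)"
  proof (intro sum.mono_neutral_right ballI)
    fix k assume "k \<in> {..<n} - {1..<n-1}"
    then have "k = 0 \<or> {k<..<n} = {}" by auto
    then show "(1 - \<sigma> k) * \<epsilon> k * corner_sum n \<alpha> k = 0" by (auto simp: corner_sum_def)
  qed auto
  have row: "(\<Sum>i<n. \<Sum>j<i. \<alpha> i j * (if Suc i = n then 0 else - \<sigma> i * \<epsilon> i))
      = (\<Sum>k\<in>{1..<n-1}. - \<sigma> k * \<epsilon> k * row_sum \<alpha> k)"
  proof -
    have "(\<Sum>i<n. \<Sum>j<i. \<alpha> i j * (if Suc i = n then 0 else - \<sigma> i * \<epsilon> i))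
        = (\<Sum>i<n. if Suc i = n then 0 else - \<sigma> i * \<epsilon> i * row_sum \<alpha> i)"
      by (intro sum.cong refl) (simp add: row_sum_def flip: sum_distrib_right)
    also have "\<dots> = (\<Sum>k\<in>{1..<n-1}. - \<sigma> k * \<epsilon> k * row_sum \<alpha> k)"
    proof (intro sum.mono_neutral_cong_right ballI)
      fix k assume "k \<in> {..<n} - {1..<n-1}"
      then have "k = 0 \<or> Suc k = n" by auto
      then show "(if Suc k = n then 0 else - \<sigma> k * \<epsilon> k * row_sum \<alpha> k) = 0" by (auto simp: row_sum_def)
    qed auto
    finally show ?thesis .
  qed
  show ?thesis
    unfolding chain_rate_def distrib_left sum.distrib swap corner inner row
    by (simp add: rotation_sum_def algebra_simps sum.distrib sum_subtractf sum_negf)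
qed

section \<open>Logarithmic derivatives along a filter\<close>

text \<open>
  The expansion \<open>f = a (1 + \<eta> \<rho>) + o(\<eta>)\<close>, where \<open>\<rho>\<close> need not converge. Along a
  filter that constrains only \<open>\<eta>\<close> the error term is uniform in the other components of the
  points \<open>p\<close>. The form is chosen without division by \<open>a\<close>, so that vanishing parameters
  are covered.
\<close>

definition relative_expansion ::
  "'p filter \<Rightarrow> ('p \<Rightarrow> real) \<Rightarrow> ('p \<Rightarrow> real) \<Rightarrow> real \<Rightarrow> ('p \<Rightarrow> real) \<Rightarrow> bool" where
  "relative_expansion F \<eta> f a \<rho> \<longleftrightarrow>
     ((\<lambda>p. (f p - a) / \<eta> p - a * \<rho> p) \<longlongrightarrow> 0) F \<and> Bfun \<rho> F"

lemma tendsto_zero_mult_Bfun: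
  fixes f g :: "'p \<Rightarrow> real"
  assumes "(f \<longlongrightarrow> 0) F" "Bfun g F"
  shows "((\<lambda>p. f p * g p) \<longlongrightarrow> 0) F"
  using bounded_bilinear.Zfun_prod_Bfun[OF bounded_bilinear_mult] assms by (simp add: tendsto_Zfun_iff)

lemma Bfun_add_real:
  fixes f g :: "'p \<Rightarrow> real"
  assumes "Bfun f F" "Bfun g F"
  shows "Bfun (\<lambda>p. f p + g p) F"
proof -
  obtain K L where "eventually (\<lambda>p. norm (f p) \<le> K) F" "eventually (\<lambda>p. norm (g p) \<le> L) F"
    using assms unfolding Bfun_def by blast
  then have "eventually (\<lambda>p. norm (f p + g p) \<le> K + L) F"
    by eventually_elim (metis norm_triangle_mono)
  then show ?thesis by (rule BfunI)
qed

lemma Bfun_cmult_real: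
  fixes f :: "'p \<Rightarrow> real"
  assumes "Bfun f F"
  shows "Bfun (\<lambda>p. c * f p) F"
proof -
  obtain K where "eventually (\<lambda>p. norm (f p) \<le> K) F"
    using assms unfolding Bfun_def by blast
  then have "eventually (\<lambda>p. norm (c * f p) \<le> \<bar>c\<bar> * K) F"
    by eventually_elim (simp add: abs_mult mult_left_mono)
  then show ?thesis by (rule BfunI)
qed

lemma relative_expansion_const: "relative_expansion F \<eta> (\<lambda>p. a) a (\<lambda>p. 0)"
  by (simp add: relative_expansion_def)

lemma relative_expansion_tendsto:
  assumes \<eta>: "filterlim \<eta> (at 0) F" and f: "relative_expansion F \<eta> f a \<rho>"
  shows "(f \<longlongrightarrow> a) F"
proof -
  have \<eta>0: "(\<eta> \<longlongrightarrow> 0) F" and nz: "eventually (\<lambda>p. \<eta> p \<noteq> 0) F"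
    using \<eta> by (auto simp: filterlim_at)
  have "((\<lambda>p. ((f p - a) / \<eta> p - a * \<rho> p) * \<eta> p + \<eta> p * (a * \<rho> p)) \<longlongrightarrow> 0 * 0 + 0) F"
    using f \<eta>0 unfolding relative_expansion_def
    by (intro tendsto_add tendsto_mult tendsto_zero_mult_Bfun Bfun_cmult_real) auto
  moreover have "eventually (\<lambda>p. ((f p - a) / \<eta> p - a * \<rho> p) * \<eta> p + \<eta> p * (a * \<rho> p) = f p - a) F"
    using nz by eventually_elim (simp add: field_simps)
  ultimately have "((\<lambda>p. f p - a) \<longlongrightarrow> 0) F"
    by (simp add: tendsto_cong)
  then show ?thesis by (simp add: LIM_zero_iff)
qed

lemma relative_expansion_mult:
  assumes \<eta>: "filterlim \<eta> (at 0) F"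
    and f: "relative_expansion F \<eta> f a \<rho>" and g: "relative_expansion F \<eta> g b \<sigma>"
  shows "relative_expansion F \<eta> (\<lambda>p. f p * g p) (a * b) (\<lambda>p. \<rho> p + \<sigma> p)"
proof -
  have ga: "(g \<longlongrightarrow> b) F" by (rule relative_expansion_tendsto[OF \<eta> g])
  have g0: "((\<lambda>p. g p - b) \<longlongrightarrow> 0) F" using ga by (simp add: LIM_zero)
  have "((\<lambda>p. ((f p - a) / \<eta> p - a * \<rho> p) * g p + a * ((g p - b) / \<eta> p - b * \<sigma> p)
      + (g p - b) * (a * \<rho> p)) \<longlongrightarrow> 0 * b + a * 0 + 0) F"
    using f g ga g0 unfolding relative_expansion_def
    by (intro tendsto_add tendsto_mult tendsto_const tendsto_zero_mult_Bfun Bfun_cmult_real) auto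
  moreover have "(\<lambda>p. ((f p - a) / \<eta> p - a * \<rho> p) * g p + a * ((g p - b) / \<eta> p - b * \<sigma> p)
      + (g p - b) * (a * \<rho> p)) = (\<lambda>p. (f p * g p - a * b) / \<eta> p - a * b * (\<rho> p + \<sigma> p))"
    by (simp add: fun_eq_iff algebra_simps diff_divide_distrib)
  ultimately show ?thesis
    using f g unfolding relative_expansion_def by (simp add: Bfun_add_real)
qed

lemma relative_expansion_prod:
  assumes \<eta>: "filterlim \<eta> (at 0) F" and "finite K"
    and "\<And>k. k \<in> K \<Longrightarrow> relative_expansion F \<eta> (f k) (a k) (\<rho> k)"
  shows "relative_expansion F \<eta> (\<lambda>p. \<Prod>k\<in>K. f k p) (\<Prod>k\<in>K. a k) (\<lambda>p. \<Sum>k\<in>K. \<rho> k p)"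
  using assms(2,3)
proof (induction K rule: finite_induct)
  case empty
  show ?case by (simp add: relative_expansion_const)
next
  case (insert k K)
  then show ?case by (simp add: relative_expansion_mult[OF \<eta>])
qed

lemma relative_expansion_param:
  assumes \<eta>: "filterlim \<eta> (at 0) F" and "Bfun \<epsilon> F"
  shows "relative_expansion F \<eta> (\<lambda>p. x + \<eta> p * \<epsilon> p * x) x \<epsilon>"
proof -
  have "eventually (\<lambda>p. \<eta> p \<noteq> 0) F" using \<eta> by (auto simp: filterlim_at)
  then have "eventually (\<lambda>p. (x + \<eta> p * \<epsilon> p * x - x) / \<eta> p - x * \<epsilon> p = 0) F"
    by eventually_elim simp
  then show ?thesis using assms(2) by (simp add: relative_expansion_def tendsto_eventually)
qed

text \<open>
  The difference quotient of \<open>g\<close> is written as a function \<open>q\<close> continuous at \<open>x\<close>, so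
  that increments equal to zero cause no exception. The number \<open>\<kappa>\<close> is the logarithmic
  derivative \<open>x g'(x) / g(x)\<close>, again without division.
\<close>

lemma relative_expansion_compose:
  assumes \<eta>: "filterlim \<eta> (at 0) F" and \<epsilon>: "Bfun \<epsilon> F"
    and g: "(g has_real_derivative D) (at x)" and \<kappa>: "x * D = g x * \<kappa>"
  shows "relative_expansion F \<eta> (\<lambda>p. g (x + \<eta> p * \<epsilon> p * x)) (g x) (\<lambda>p. \<kappa> * \<epsilon> p)"
proof -
  obtain q where q: "\<And>z. g z - g x = q z * (z - x)" and cont: "isCont q x" and qx: "q x = D"
    using g unfolding CARAT_DERIV by blast
  have x: "((\<lambda>p. x + \<eta> p * \<epsilon> p * x) \<longlongrightarrow> x) F"
    by (rule relative_expansion_tendsto[OF \<eta> relative_expansion_param[OF \<eta> \<epsilon>]])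
  have "((\<lambda>p. q (x + \<eta> p * \<epsilon> p * x) - D) \<longlongrightarrow> D - D) F"
    using isCont_tendsto_compose[OF cont x] qx by (intro tendsto_diff tendsto_const) simp
  then have "((\<lambda>p. (q (x + \<eta> p * \<epsilon> p * x) - D) * (x * \<epsilon> p)) \<longlongrightarrow> 0) F"
    using \<epsilon> by (intro tendsto_zero_mult_Bfun Bfun_cmult_real) auto
  moreover have "eventually (\<lambda>p. (q (x + \<eta> p * \<epsilon> p * x) - D) * (x * \<epsilon> p)
      = (g (x + \<eta> p * \<epsilon> p * x) - g x) / \<eta> p - g x * (\<kappa> * \<epsilon> p)) F"
  proof -
    have "eventually (\<lambda>p. \<eta> p \<noteq> 0) F" using \<eta> by (auto simp: filterlim_at)
    then show ?thesis
    proof eventually_elim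
      case (elim p)
      then show ?case
        unfolding q mult.assoc[symmetric] \<kappa>[symmetric] by (simp add: algebra_simps)
    qed
  qed
  ultimately show ?thesis
    using \<epsilon> by (simp add: relative_expansion_def tendsto_cong Bfun_cmult_real)
qed

section \<open>Expansion of the tangent-Givens-vector entries\<close>

lemma has_derivative_givens_sin:
  "((\<lambda>t. t / sqrt (1 + t\<^sup>2)) has_real_derivative 1 / ((1 + x\<^sup>2) * sqrt (1 + x\<^sup>2))) (at x)"
proof -
  have p: "1 + x\<^sup>2 > 0" by (simp add: add_pos_nonneg)
  have "sqrt (1 + x\<^sup>2) * sqrt (1 + x\<^sup>2) = 1 + x\<^sup>2" using p by simp
  then have "(1 * sqrt (1 + x\<^sup>2) - x * (2 * x * (inverse (sqrt (1 + x\<^sup>2)) / 2))) / (sqrt (1 + x\<^sup>2) * sqrt (1 + x\<^sup>2))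
      = 1 / ((1 + x\<^sup>2) * sqrt (1 + x\<^sup>2))"
    using p by (simp add: divide_simps power2_eq_square) 
  then show ?thesis
    using p by (auto intro!: derivative_eq_intros simp: power2_eq_square field_simps)
qed

lemma has_derivative_givens_cos:
  "((\<lambda>t. 1 / sqrt (1 + t\<^sup>2)) has_real_derivative - x / ((1 + x\<^sup>2) * sqrt (1 + x\<^sup>2))) (at x)"
proof -
  have p: "1 + x\<^sup>2 > 0" by (simp add: add_pos_nonneg)
  then show ?thesis
    by (auto intro!: derivative_eq_intros simp: divide_simps)
qed

lemma givens_sin_sq: "(givens_sin x k)\<^sup>2 = (x k)\<^sup>2 / (1 + (x k)\<^sup>2)"
  by (simp add: givens_sin_def power_divide add_nonneg_nonneg)

lemma givens_sin_sq_bounds: "0 \<le> (givens_sin x k)\<^sup>2 \<and> (givens_sin x k)\<^sup>2 \<le> 1"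
  unfolding givens_sin_sq by (simp add: divide_le_eq add_pos_nonneg)

lemma relative_expansion_givens_sin:
  assumes "filterlim \<eta> (at 0) F" "Bfun (\<lambda>p. e p k) F"
  shows "relative_expansion F \<eta> (\<lambda>p. givens_sin (\<lambda>i. x i + \<eta> p * e p i * x i) k) (givens_sin x k)
    (\<lambda>p. (1 - (givens_sin x k)\<^sup>2) * e p k)"
  unfolding givens_sin_def
proof (rule relative_expansion_compose[OF assms has_derivative_givens_sin])
  have p: "1 + (x k)\<^sup>2 > 0" by (simp add: add_pos_nonneg)
  show "x k * (1 / ((1 + (x k)\<^sup>2) * sqrt (1 + (x k)\<^sup>2)))
      = x k / sqrt (1 + (x k)\<^sup>2) * (1 - (x k / sqrt (1 + (x k)\<^sup>2))\<^sup>2)"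
    using p by (simp add: power_divide field_simps)
qed

lemma relative_expansion_givens_cos:
  assumes "filterlim \<eta> (at 0) F" "Bfun (\<lambda>p. e p k) F"
  shows "relative_expansion F \<eta> (\<lambda>p. givens_cos n (\<lambda>i. x i + \<eta> p * e p i * x i) k) (givens_cos n x k)
    (\<lambda>p. if k = n then 0 else - (givens_sin x k)\<^sup>2 * e p k)"
proof (cases "k = n")
  case True
  then show ?thesis by (simp add: givens_cos_def relative_expansion_const)
next
  case False
  have p: "1 + (x k)\<^sup>2 > 0" by (simp add: add_pos_nonneg)
  have "x k * (- x k / ((1 + (x k)\<^sup>2) * sqrt (1 + (x k)\<^sup>2)))
      = 1 / sqrt (1 + (x k)\<^sup>2) * (- (givens_sin x k)\<^sup>2)"
    unfolding givens_sin_sq using p by (simp add: power2_eq_square)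
  from relative_expansion_compose[OF assms has_derivative_givens_cos this] False
  show ?thesis by (simp add: givens_cos_def)
qed

lemma relative_expansion_chain:
  assumes \<eta>: "filterlim \<eta> (at 0) F" and "\<And>k. Bfun (\<lambda>p. e p k) F" "\<And>k. Bfun (\<lambda>p. \<nu> p k) F"
  shows "relative_expansion F \<eta>
    (\<lambda>p. givens_cos n (\<lambda>i. x i + \<eta> p * e p i * x i) (Suc i)
      * (\<Prod>k\<in>{Suc j<..<Suc i}. givens_sin (\<lambda>i. x i + \<eta> p * e p i * x i) k)
      * (v (Suc j) + \<eta> p * \<nu> p (Suc j) * v (Suc j)))
    (givens_cos n x (Suc i) * (\<Prod>k\<in>{Suc j<..<Suc i}. givens_sin x k) * v (Suc j))
    (\<lambda>p. chain_rate n (\<lambda>k. (givens_sin x (Suc k))\<^sup>2) (\<lambda>k. e p (Suc k)) (\<lambda>k. \<nu> p (Suc k)) i j)"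
proof -
  have "(\<Sum>k\<in>{j<..<i}. (1 - (givens_sin x (Suc k))\<^sup>2) * e p (Suc k))
      = (\<Sum>k\<in>{Suc j<..<Suc i}. (1 - (givens_sin x k)\<^sup>2) * e p k)" for p
    by (rule sum.reindex_bij_witness[of _ "\<lambda>k. k - 1" Suc]) auto
  then show ?thesis
    unfolding chain_rate_def
    using relative_expansion_mult[OF \<eta> relative_expansion_mult[OF \<eta>
          relative_expansion_givens_cos[OF \<eta>, where e = e and k = "Suc i" and n = n and x = x]
          relative_expansion_prod[OF \<eta> _ relative_expansion_givens_sin[OF \<eta>, where e = e and x = x], of "{Suc j<..<Suc i}"]]
          relative_expansion_param[OF \<eta>, of "\<lambda>p. \<nu> p (Suc j)" "v (Suc j)"]] assms
    by simp
qed

text \<open>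
  Perturbations are parametrised by their relative size in units of \<open>\<eta>\<close>, so that the
  admissible ones are described by a box that does not depend on \<open>\<eta>\<close> or \<open>\<Omega>\<close>.
\<close>

definition gv_rel :: "real \<Rightarrow> gv_params \<Rightarrow> gv_params \<Rightarrow> gv_params" where
  "gv_rel \<eta> e \<Omega> = GV (\<lambda>i. \<eta> * gv_l e i * gv_l \<Omega> i) (\<lambda>i. \<eta> * gv_v e i * gv_v \<Omega> i)
     (\<lambda>i. \<eta> * gv_d e i * gv_d \<Omega> i) (\<lambda>i. \<eta> * gv_w e i * gv_w \<Omega> i) (\<lambda>i. \<eta> * gv_u e i * gv_u \<Omega> i)"

definition gv_rate :: "nat \<Rightarrow> gv_params \<Rightarrow> gv_params \<Rightarrow> nat \<Rightarrow> nat \<Rightarrow> real" where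
  "gv_rate n \<Omega> e i j =
     (if i = j then gv_d e (Suc i)
      else if j < i then
        chain_rate n (\<lambda>k. (givens_sin (gv_l \<Omega>) (Suc k))\<^sup>2) (\<lambda>k. gv_l e (Suc k)) (\<lambda>k. gv_v e (Suc k)) i j
      else
        chain_rate n (\<lambda>k. (givens_sin (gv_u \<Omega>) (Suc k))\<^sup>2) (\<lambda>k. gv_u e (Suc k)) (\<lambda>k. gv_w e (Suc k)) j i)"

definition unit_gv :: "gv_params \<Rightarrow> bool" where
  "unit_gv e \<longleftrightarrow> (\<forall>i. \<bar>gv_l e i\<bar> \<le> 1 \<and> \<bar>gv_v e i\<bar> \<le> 1 \<and> \<bar>gv_d e i\<bar> \<le> 1 \<and> \<bar>gv_w e i\<bar> \<le> 1 \<and> \<bar>gv_u e i\<bar> \<le> 1)"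

text \<open>
  The size tends to 0 while the direction is arbitrary in the box: limits along this filter are
  limits for \<open>\<eta>\<close> tending to 0 that are uniform in the direction.
\<close>

definition perturbations :: "(real \<times> gv_params) filter" where
  "perturbations = at_right 0 \<times>\<^sub>F principal {e. unit_gv e}"

lemma eventually_perturbations:
  "eventually P perturbations \<longleftrightarrow> eventually (\<lambda>\<eta>. \<forall>e. unit_gv e \<longrightarrow> P (\<eta>, e)) (at_right 0)"
proof
  assume "eventually P perturbations"
  then show "eventually (\<lambda>\<eta>. \<forall>e. unit_gv e \<longrightarrow> P (\<eta>, e)) (at_right 0)"
    unfolding perturbations_def eventually_prod_filter eventually_principal
    by (auto elim!: eventually_mono)
next
  assume "eventually (\<lambda>\<eta>. \<forall>e. unit_gv e \<longrightarrow> P (\<eta>, e)) (at_right 0)"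
  then show "eventually P perturbations"
    unfolding perturbations_def eventually_prod_filter eventually_principal
    by (intro exI[of _ "\<lambda>\<eta>. \<forall>e. unit_gv e \<longrightarrow> P (\<eta>, e)"] exI[of _ unit_gv]) auto
qed

lemma filterlim_fst_perturbations: "filterlim fst (at 0) perturbations"
proof -
  have "filterlim fst (at_right 0) perturbations"
    unfolding perturbations_def filterlim_def by (rule filtermap_fst_prod_filter)
  then show ?thesis by (rule filterlim_mono) (auto simp: at_le)
qed

lemma Bfun_unit_gv:
  "Bfun (\<lambda>p. gv_l (snd p) k) perturbations" "Bfun (\<lambda>p. gv_v (snd p) k) perturbations"
  "Bfun (\<lambda>p. gv_d (snd p) k) perturbations" "Bfun (\<lambda>p. gv_w (snd p) k) perturbations"
  "Bfun (\<lambda>p. gv_u (snd p) k) perturbations"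
  by (auto intro!: BfunI[where K = 1] simp: eventually_perturbations unit_gv_def)

lemma relative_expansion_gv_entry:
  "relative_expansion perturbations fst (\<lambda>p. gv_entry n (gv_add \<Omega> (gv_rel (fst p) (snd p) \<Omega>)) (Suc i) (Suc j))
    (gv_entry n \<Omega> (Suc i) (Suc j)) (\<lambda>p. gv_rate n \<Omega> (snd p) i j)"
proof -
  note \<eta> = filterlim_fst_perturbations
  consider "i = j" | "j < i" | "i < j" by linarith
  then show ?thesis
  proof cases
    case 1
    with relative_expansion_param[OF \<eta> Bfun_unit_gv(3)[of "Suc j"], of "gv_d \<Omega> (Suc j)"] show ?thesis
      by (simp add: gv_entry_def gv_add_def gv_rel_def gv_rate_def)
  next
    case 2
    with relative_expansion_chain[OF \<eta> Bfun_unit_gv(1,2), where n = n and x = "gv_l \<Omega>" and v = "gv_v \<Omega>" and i = i and j = j] show ?thesis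
      by (simp add: gv_entry_def gv_add_def gv_rel_def gv_rate_def)
  next
    case 3
    with relative_expansion_chain[OF \<eta> Bfun_unit_gv(5,4), where n = n and x = "gv_u \<Omega>" and v = "gv_w \<Omega>" and i = j and j = i] show ?thesis
      by (simp add: gv_entry_def gv_add_def gv_rel_def gv_rate_def mult_ac)
  qed
qed

section \<open>Perturbed linear systems in the maximum norm\<close>

lemma finite_elements_mat: "finite (elements_mat Z)"
  by (simp add: elements_mat_def)

lemma abs_entry_le_max_norm:
  assumes "Z \<in> carrier_mat n m" "i < n" "j < m"
  shows "\<bar>Z $$ (i, j)\<bar> \<le> max_norm Z"
proof -
  have "Z $$ (i, j) \<in> elements_mat Z" by (rule elements_matI[OF assms refl])
  then show ?thesis
    unfolding max_norm_def by (intro Max_ge finite_imageI finite_elements_mat imageI)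
qed

lemma max_norm_attained:
  assumes "Z \<in> carrier_mat n m" "0 < n" "0 < m"
  obtains i j where "i < n" "j < m" "max_norm Z = \<bar>Z $$ (i, j)\<bar>"
proof -
  have "Z $$ (0, 0) \<in> elements_mat Z" by (rule elements_matI[OF assms refl])
  then have "max_norm Z \<in> abs ` elements_mat Z"
    unfolding max_norm_def by (intro Max_in finite_imageI finite_elements_mat) auto
  then obtain z where z: "z \<in> elements_mat Z" "max_norm Z = \<bar>z\<bar>" by blast
  then obtain i j where "i < dim_row Z" "j < dim_col Z" "z = Z $$ (i, j)" by blast
  then show ?thesis using that z(2) assms(1) by auto
qed

lemma max_norm_le:
  assumes "Z \<in> carrier_mat n m" "0 < n" "0 < m" "\<And>i j. i < n \<Longrightarrow> j < m \<Longrightarrow> \<bar>Z $$ (i, j)\<bar> \<le> b"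
  shows "max_norm Z \<le> b"
  by (rule max_norm_attained[OF assms(1-3)]) (simp add: assms(4))

lemma max_norm_nonneg:
  assumes "Z \<in> carrier_mat n m" "0 < n" "0 < m"
  shows "0 \<le> max_norm Z"
  by (rule max_norm_attained[OF assms]) simp

lemma mult_mat_entry:
  assumes "P \<in> carrier_mat n k" "Q \<in> carrier_mat k m" "i < n" "j < m"
  shows "(P * Q) $$ (i, j) = (\<Sum>l<k. P $$ (i, l) * Q $$ (l, j))"
  using assms by (simp add: scalar_prod_def lessThan_atLeast0)

lemma mult_mat3_entry:
  fixes P Q R :: "real mat"
  assumes "P \<in> carrier_mat n k" "Q \<in> carrier_mat k l" "R \<in> carrier_mat l m" "i < n" "j < m"
  shows "(P * Q * R) $$ (i, j) = (\<Sum>a<k. \<Sum>b<l. P $$ (i, a) * Q $$ (a, b) * R $$ (b, j))"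
proof -
  have PQ: "P * Q \<in> carrier_mat n l" using assms by simp
  have "(P * Q * R) $$ (i, j) = (\<Sum>b<l. (\<Sum>a<k. P $$ (i, a) * Q $$ (a, b)) * R $$ (b, j))"
    unfolding mult_mat_entry[OF PQ assms(3-5)]
    by (intro sum.cong refl) (simp only: mult_mat_entry[OF assms(1,2,4)] lessThan_iff)
  also have "\<dots> = (\<Sum>a<k. \<Sum>b<l. P $$ (i, a) * Q $$ (a, b) * R $$ (b, j))"
    unfolding sum_distrib_right by (rule sum.swap)
  finally show ?thesis .
qed

lemma mult_abs_mat_entry:
  assumes "P \<in> carrier_mat n k" "Q \<in> carrier_mat k m" "i < n" "j < m"
  shows "(abs_mat P * abs_mat Q) $$ (i, j) = (\<Sum>l<k. \<bar>P $$ (i, l)\<bar> * \<bar>Q $$ (l, j)\<bar>)"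
proof -
  have "abs_mat P \<in> carrier_mat n k" "abs_mat Q \<in> carrier_mat k m"
    using assms(1,2) by (auto simp: abs_mat_def)
  from mult_mat_entry[OF this assms(3,4)] show ?thesis
    using assms by (simp add: abs_mat_def)
qed

lemma mat_inverse_correct:
  assumes "A \<in> carrier_mat n n" "A \<in> Units (ring_mat TYPE(real) n undefined)"
  obtains W where "mat_inverse A = Some W" "W \<in> carrier_mat n n" "A * W = 1\<^sub>m n" "W * A = 1\<^sub>m n"
proof (cases "mat_inverse A")
  case None
  then show ?thesis using mat_inverse(1)[OF assms(1), of undefined] assms(2) by blast
next
  case (Some W)
  then show ?thesis using mat_inverse(2)[OF assms(1) Some] that by blast
qed

lemma inv_mat_correct:
  assumes A: "A \<in> carrier_mat n n" and "invertible_mat A"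
  shows "inv_mat A \<in> carrier_mat n n" "inv_mat A * A = 1\<^sub>m n"
proof -
  obtain W where W: "A * W = 1\<^sub>m (dim_row A)" "W * A = 1\<^sub>m (dim_row W)"
    using assms(2) unfolding invertible_mat_def inverts_mat_def by blast
  have "dim_col W = n" using arg_cong[OF W(1), of dim_col] A by simp
  moreover have "dim_row W = n" using arg_cong[OF W(2), of dim_col] A by simp
  ultimately have "A \<in> Units (ring_mat TYPE(real) n undefined)"
    using A W unfolding Units_def by (auto simp: ring_mat_simps intro!: bexI[of _ W])
  then obtain W where "mat_inverse A = Some W" "W \<in> carrier_mat n n" "W * A = 1\<^sub>m n"
    by (rule mat_inverse_correct[OF A])
  then show "inv_mat A \<in> carrier_mat n n" "inv_mat A * A = 1\<^sub>m n"
    unfolding inv_mat_def by simp_all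
qed

lemma abs_mult_mat_le_row_sum:
  fixes E D :: "real mat"
  assumes E: "E \<in> carrier_mat n n" and D: "D \<in> carrier_mat n m" and "i < n" "j < m"
    and row: "(\<Sum>k<n. \<bar>E $$ (i, k)\<bar>) \<le> \<tau>"
  shows "\<bar>(E * D) $$ (i, j)\<bar> \<le> \<tau> * max_norm D"
proof -
  have "\<bar>(E * D) $$ (i, j)\<bar> \<le> (\<Sum>k<n. \<bar>E $$ (i, k)\<bar> * max_norm D)"
    unfolding mult_mat_entry[OF E D \<open>i < n\<close> \<open>j < m\<close>]
    using abs_entry_le_max_norm[OF D] \<open>j < m\<close>
    by (intro order_trans[OF sum_abs] sum_mono) (simp add: abs_mult mult_left_mono)
  also have "\<dots> \<le> \<tau> * max_norm D"
    unfolding sum_distrib_right[symmetric]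
    using row max_norm_nonneg[OF D] assms(3,4) by (intro mult_right_mono) auto
  finally show ?thesis .
qed

text \<open>
  For a perturbation \<open>E\<close> of the identity with small absolute row sums, \<open>E * D\<close> is small
  compared with \<open>D\<close>, so the solution and the right-hand side have almost the same norm.
\<close>

lemma perturbed_identity_bounds:
  fixes E D H :: "real mat"
  assumes E: "E \<in> carrier_mat n n" and D: "D \<in> carrier_mat n m" and "0 < n" "0 < m"
    and row: "\<And>i. i < n \<Longrightarrow> (\<Sum>k<n. \<bar>E $$ (i, k)\<bar>) \<le> \<tau>"
    and H: "D + E * D = H"
  shows "max_norm D \<le> max_norm H + \<tau> * max_norm D" "max_norm H \<le> (1 + \<tau>) * max_norm D"
proof -
  have Hc: "H \<in> carrier_mat n m" using H E D by auto
  have eq: "H $$ (i, j) = D $$ (i, j) + (E * D) $$ (i, j)" if "i < n" "j < m" for i j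
    using that E D unfolding H[symmetric] by simp
  show "max_norm D \<le> max_norm H + \<tau> * max_norm D"
  proof (rule max_norm_le[OF D \<open>0 < n\<close> \<open>0 < m\<close>])
    fix i j assume ij: "i < n" "j < m"
    show "\<bar>D $$ (i, j)\<bar> \<le> max_norm H + \<tau> * max_norm D"
      using eq[OF ij] abs_mult_mat_le_row_sum[OF E D ij row[OF ij(1)]] abs_entry_le_max_norm[OF Hc ij] by linarith
  qed
  show "max_norm H \<le> (1 + \<tau>) * max_norm D"
  proof (rule max_norm_le[OF Hc \<open>0 < n\<close> \<open>0 < m\<close>])
    fix i j assume ij: "i < n" "j < m"
    show "\<bar>H $$ (i, j)\<bar> \<le> (1 + \<tau>) * max_norm D"
      using eq[OF ij] abs_mult_mat_le_row_sum[OF E D ij row[OF ij(1)]] abs_entry_le_max_norm[OF D ij]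
      by (simp add: distrib_right)
  qed
qed

lemma left_inverse_mult_perturbed:
  fixes A A' Y Z :: "real mat"
  assumes "A \<in> carrier_mat n n" "A' \<in> carrier_mat n n" "Y \<in> carrier_mat n n" "Z \<in> carrier_mat n m"
    and "Y * A = 1\<^sub>m n"
  shows "Y * (A' * Z) = Z + Y * (A' - A) * Z"
proof -
  have D: "A' - A \<in> carrier_mat n n" using assms(1) by (rule minus_carrier_mat)
  have "A + (A' - A) = A'" using assms by (intro eq_matI) auto
  then have "Y * A' = 1\<^sub>m n + Y * (A' - A)"
    using mult_add_distrib_mat[of Y n n A n "A' - A"] assms D by simp
  then have "Y * A' * Z = 1\<^sub>m n * Z + Y * (A' - A) * Z"
    using add_mult_distrib_mat[of "1\<^sub>m n" n n "Y * (A' - A)" Z m] assms D by simp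
  then show ?thesis using assms assoc_mult_mat[of Y n n A' n Z m] by simp
qed

text \<open>
  A vector in the kernel of \<open>A'\<close> solves the perturbed identity with right-hand side 0, and
  therefore vanishes because \<open>\<tau> < 1\<close>.
\<close>

lemma perturbed_system_solvable:
  fixes A A' Y B :: "real mat"
  assumes A: "A \<in> carrier_mat n n" "A' \<in> carrier_mat n n" "Y \<in> carrier_mat n n" and YA: "Y * A = 1\<^sub>m n"
    and "0 < n" "B \<in> carrier_mat n m"
    and row: "\<And>i. i < n \<Longrightarrow> (\<Sum>k<n. \<bar>(Y * (A' - A)) $$ (i, k)\<bar>) \<le> \<tau>" and "\<tau> < 1"
  obtains Z where "Z \<in> carrier_mat n m" "A' * Z = B"
proof -
  have E: "Y * (A' - A) \<in> carrier_mat n n"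
    using A(3) minus_carrier_mat[OF A(1)] by (rule mult_carrier_mat)
  have "det A' \<noteq> 0"
  proof
    assume "det A' = 0"
    then obtain v where v: "v \<in> carrier_vec n" "v \<noteq> 0\<^sub>v n" "A' *\<^sub>v v = 0\<^sub>v n"
      using det_0_iff_vec_prod_zero[OF A(2)] by blast
    define V where "V = mat_of_cols n [v]"
    have V: "V \<in> carrier_mat n 1" by (auto simp: V_def)
    have "A' * V = 0\<^sub>m n 1"
    proof (rule eq_matI)
      fix i j assume "i < dim_row (0\<^sub>m n 1 :: real mat)" "j < dim_col (0\<^sub>m n 1 :: real mat)"
      then have ij: "i < n" "j = 0" by auto
      have "(A' * V) $$ (i, j) = vec_index (A' *\<^sub>v v) i"
        using ij A v(1) by (simp add: V_def)
      then show "(A' * V) $$ (i, j) = (0\<^sub>m n 1) $$ (i, j)" using ij v(3) by simp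
    qed (use A V in auto)
    then have "V + Y * (A' - A) * V = 0\<^sub>m n 1"
      using left_inverse_mult_perturbed[OF A V YA] A(3) by simp
    from perturbed_identity_bounds(1)[OF E V \<open>0 < n\<close> _ row this]
    have "max_norm V \<le> max_norm (0\<^sub>m n 1) + \<tau> * max_norm V" by simp
    moreover have "max_norm (0\<^sub>m n 1) \<le> 0"
      using \<open>0 < n\<close> by (intro max_norm_le[of _ n 1]) auto
    ultimately have "(1 - \<tau>) * max_norm V \<le> 0" by (simp add: algebra_simps)
    then have "max_norm V \<le> 0" using \<open>\<tau> < 1\<close> by (simp add: mult_le_0_iff)
    moreover have "V $$ (i, 0) = vec_index v i" if "i < n" for i
      using that v(1) by (simp add: V_def mat_of_cols_def)
    ultimately have "vec_index v i = 0" if "i < n" for i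
      using abs_entry_le_max_norm[OF V that, of 0] that by fastforce
    with v(1,2) show False by (auto intro: eq_vecI)
  qed
  from mat_inverse_correct[OF A(2) det_non_zero_imp_unit[OF A(2) this]]
  obtain W where W: "W \<in> carrier_mat n n" "A' * W = 1\<^sub>m n" by blast
  show ?thesis
  proof (rule that)
    show "W * B \<in> carrier_mat n m" using W(1) \<open>B \<in> carrier_mat n m\<close> by simp
    show "A' * (W * B) = B"
      using assoc_mult_mat[OF A(2) W(1) \<open>B \<in> carrier_mat n m\<close>] W(2) \<open>B \<in> carrier_mat n m\<close> by simp
  qed
qed

section \<open>The supremum of the linearisation over the unit box\<close>

definition chain_sensitivity :: "nat \<Rightarrow> (nat \<Rightarrow> real) \<Rightarrow> (nat \<Rightarrow> nat \<Rightarrow> real) \<Rightarrow> real" where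
  "chain_sensitivity n \<sigma> \<alpha> =
     (\<Sum>j<n. \<bar>col_sum n \<alpha> j\<bar>) + (\<Sum>k\<in>{1..<n-1}. \<bar>rotation_sum n \<sigma> \<alpha> k\<bar>)"

lemma sum_chain_rate_le:
  assumes "\<And>k. \<bar>\<epsilon> k\<bar> \<le> 1" "\<And>k. \<bar>\<nu> k\<bar> \<le> 1"
  shows "\<bar>\<Sum>i<n. \<Sum>j<i. \<alpha> i j * chain_rate n \<sigma> \<epsilon> \<nu> i j\<bar> \<le> chain_sensitivity n \<sigma> \<alpha>"
proof -
  have "\<bar>\<Sum>j<n. \<nu> j * col_sum n \<alpha> j\<bar> \<le> (\<Sum>j<n. \<bar>col_sum n \<alpha> j\<bar>)"
    using assms(2) by (intro order_trans[OF sum_abs] sum_mono) (simp add: abs_mult mult_left_le_one_le)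
  moreover have "\<bar>\<Sum>k\<in>{1..<n-1}. \<epsilon> k * rotation_sum n \<sigma> \<alpha> k\<bar> \<le> (\<Sum>k\<in>{1..<n-1}. \<bar>rotation_sum n \<sigma> \<alpha> k\<bar>)"
    using assms(1) by (intro order_trans[OF sum_abs] sum_mono) (simp add: abs_mult mult_left_le_one_le)
  ultimately show ?thesis
    unfolding sum_chain_rate chain_sensitivity_def by linarith
qed

lemma sum_chain_rate_attained:
  "(\<Sum>i<n. \<Sum>j<i. \<alpha> i j * chain_rate n \<sigma> (\<lambda>k. sgn (rotation_sum n \<sigma> \<alpha> k)) (\<lambda>k. sgn (col_sum n \<alpha> k)) i j)
     = chain_sensitivity n \<sigma> \<alpha>"
proof -
  have "sgn x * x = \<bar>x\<bar>" for x :: real by (simp add: sgn_if)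
  then show ?thesis unfolding sum_chain_rate chain_sensitivity_def by presburger
qed

definition gv_sensitivity :: "nat \<Rightarrow> gv_params \<Rightarrow> (nat \<Rightarrow> nat \<Rightarrow> real) \<Rightarrow> real" where
  "gv_sensitivity n \<Omega> \<alpha> = (\<Sum>i<n. \<bar>\<alpha> i i\<bar>)
     + chain_sensitivity n (\<lambda>k. (givens_sin (gv_l \<Omega>) (Suc k))\<^sup>2) \<alpha>
     + chain_sensitivity n (\<lambda>k. (givens_sin (gv_u \<Omega>) (Suc k))\<^sup>2) (\<lambda>i j. \<alpha> j i)"

lemma sum_triangles:
  fixes f :: "nat \<Rightarrow> nat \<Rightarrow> real"
  shows "(\<Sum>i<n. \<Sum>j<n. f i j) = (\<Sum>i<n. f i i) + (\<Sum>i<n. \<Sum>j<i. f i j) + (\<Sum>i<n. \<Sum>j<i. f j i)"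
proof (induction n)
  case (Suc n)
  then show ?case by (simp add: sum.distrib)
qed simp

lemma sum_gv_rate:
  "(\<Sum>i<n. \<Sum>j<n. \<alpha> i j * gv_rate n \<Omega> e i j) = (\<Sum>i<n. \<alpha> i i * gv_d e (Suc i))
     + (\<Sum>i<n. \<Sum>j<i. \<alpha> i j * chain_rate n (\<lambda>k. (givens_sin (gv_l \<Omega>) (Suc k))\<^sup>2)
          (\<lambda>k. gv_l e (Suc k)) (\<lambda>k. gv_v e (Suc k)) i j)
     + (\<Sum>i<n. \<Sum>j<i. \<alpha> j i * chain_rate n (\<lambda>k. (givens_sin (gv_u \<Omega>) (Suc k))\<^sup>2)
          (\<lambda>k. gv_u e (Suc k)) (\<lambda>k. gv_w e (Suc k)) i j)"
  unfolding sum_triangles by (intro arg_cong2[of _ _ _ _ "(+)"] sum.cong refl) (simp_all add: gv_rate_def)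

lemma sum_gv_rate_le:
  assumes "unit_gv e"
  shows "\<bar>\<Sum>i<n. \<Sum>j<n. \<alpha> i j * gv_rate n \<Omega> e i j\<bar> \<le> gv_sensitivity n \<Omega> \<alpha>"
proof -
  note e = assms[unfolded unit_gv_def, rule_format]
  have "\<bar>\<Sum>i<n. \<alpha> i i * gv_d e (Suc i)\<bar> \<le> (\<Sum>i<n. \<bar>\<alpha> i i\<bar>)"
    using e by (intro order_trans[OF sum_abs] sum_mono) (simp add: abs_mult mult_right_le_one_le)
  moreover have "\<bar>\<Sum>i<n. \<Sum>j<i. \<alpha> i j * chain_rate n (\<lambda>k. (givens_sin (gv_l \<Omega>) (Suc k))\<^sup>2)
      (\<lambda>k. gv_l e (Suc k)) (\<lambda>k. gv_v e (Suc k)) i j\<bar>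
      \<le> chain_sensitivity n (\<lambda>k. (givens_sin (gv_l \<Omega>) (Suc k))\<^sup>2) \<alpha>"
    using e by (intro sum_chain_rate_le) simp_all
  moreover have "\<bar>\<Sum>i<n. \<Sum>j<i. \<alpha> j i * chain_rate n (\<lambda>k. (givens_sin (gv_u \<Omega>) (Suc k))\<^sup>2)
      (\<lambda>k. gv_u e (Suc k)) (\<lambda>k. gv_w e (Suc k)) i j\<bar>
      \<le> chain_sensitivity n (\<lambda>k. (givens_sin (gv_u \<Omega>) (Suc k))\<^sup>2) (\<lambda>i j. \<alpha> j i)"
    using e by (intro sum_chain_rate_le[of _ _ "\<lambda>i j. \<alpha> j i"]) simp_all
  ultimately show ?thesis
    unfolding sum_gv_rate gv_sensitivity_def by linarith
qed

text \<open>
  The direction consists of the signs of the coefficients; parameters are numbered from 1 and array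
  indices from 0, hence the shifts by 1.
\<close>

lemma sum_gv_rate_attained:
  obtains e where "unit_gv e" "(\<Sum>i<n. \<Sum>j<n. \<alpha> i j * gv_rate n \<Omega> e i j) = gv_sensitivity n \<Omega> \<alpha>"
proof
  let ?e = "GV (\<lambda>k. sgn (rotation_sum n (\<lambda>k. (givens_sin (gv_l \<Omega>) (Suc k))\<^sup>2) \<alpha> (k - 1)))
    (\<lambda>k. sgn (col_sum n \<alpha> (k - 1))) (\<lambda>k. sgn (\<alpha> (k - 1) (k - 1)))
    (\<lambda>k. sgn (col_sum n (\<lambda>i j. \<alpha> j i) (k - 1)))
    (\<lambda>k. sgn (rotation_sum n (\<lambda>k. (givens_sin (gv_u \<Omega>) (Suc k))\<^sup>2) (\<lambda>i j. \<alpha> j i) (k - 1)))"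
  show "unit_gv ?e" by (simp add: unit_gv_def abs_sgn_eq)
  have "x * sgn x = \<bar>x\<bar>" for x :: real by (simp add: sgn_if)
  then show "(\<Sum>i<n. \<Sum>j<n. \<alpha> i j * gv_rate n \<Omega> ?e i j) = gv_sensitivity n \<Omega> \<alpha>"
    unfolding sum_gv_rate gv_sensitivity_def gv_params.sel diff_Suc_1
    using sum_chain_rate_attained[of \<alpha>] sum_chain_rate_attained[of "\<lambda>i j. \<alpha> j i"] by simp
qed

lemma gv_mat_cong:
  assumes rot: "\<And>k. k \<in> {2..n-1} \<Longrightarrow> gv_l \<Omega> k = gv_l \<Omega>' k \<and> gv_u \<Omega> k = gv_u \<Omega>' k"
    and vec: "\<And>k. k \<in> {1..n-1} \<Longrightarrow> gv_v \<Omega> k = gv_v \<Omega>' k \<and> gv_w \<Omega> k = gv_w \<Omega>' k"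
    and diag: "\<And>k. k \<in> {1..n} \<Longrightarrow> gv_d \<Omega> k = gv_d \<Omega>' k"
  shows "gv_mat n \<Omega> = gv_mat n \<Omega>'"
proof -
  have sin: "givens_sin x k = givens_sin y k" if "x k = y k" for x y k
    unfolding givens_sin_def that ..
  have cos: "givens_cos n x k = givens_cos n y k" if "k \<noteq> n \<Longrightarrow> x k = y k" for x y k
  proof (cases "k = n")
    case False
    from that[OF this] show ?thesis by (simp only: givens_cos_def)
  qed (simp add: givens_cos_def)
  have lower: "gv_entry n \<Omega> i j = gv_entry n \<Omega>' i j" if "1 \<le> j" "j < i" "i \<le> n" for i j
  proof -
    have "givens_cos n (gv_l \<Omega>) i = givens_cos n (gv_l \<Omega>') i"
      using that by (intro cos rot[THEN conjunct1]) auto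
    moreover have "(\<Prod>k\<in>{j<..<i}. givens_sin (gv_l \<Omega>) k) = (\<Prod>k\<in>{j<..<i}. givens_sin (gv_l \<Omega>') k)"
      using that by (intro prod.cong refl sin rot[THEN conjunct1]) auto
    moreover have "gv_v \<Omega> j = gv_v \<Omega>' j" using that by (intro vec[THEN conjunct1]) auto
    moreover have "j < i" "i \<noteq> j" using that(2) by auto
    ultimately show ?thesis by (simp only: gv_entry_def if_True if_False)
  qed
  have upper: "gv_entry n \<Omega> i j = gv_entry n \<Omega>' i j" if "1 \<le> i" "i < j" "j \<le> n" for i j
  proof -
    have "givens_cos n (gv_u \<Omega>) j = givens_cos n (gv_u \<Omega>') j"
      using that by (intro cos rot[THEN conjunct2]) auto
    moreover have "(\<Prod>k\<in>{i<..<j}. givens_sin (gv_u \<Omega>) k) = (\<Prod>k\<in>{i<..<j}. givens_sin (gv_u \<Omega>') k)"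
      using that by (intro prod.cong refl sin rot[THEN conjunct2]) auto
    moreover have "gv_w \<Omega> i = gv_w \<Omega>' i" using that by (intro vec[THEN conjunct2]) auto
    moreover have "\<not> j < i" "i \<noteq> j" using that(2) by auto
    ultimately show ?thesis by (simp only: gv_entry_def if_False)
  qed
  have "gv_entry n \<Omega> (Suc i) (Suc j) = gv_entry n \<Omega>' (Suc i) (Suc j)" if "i < n" "j < n" for i j
  proof -
    consider "i = j" | "j < i" | "i < j" by linarith
    then show ?thesis
    proof cases
      case 1
      then show ?thesis using that diag[of "Suc i"] by (simp add: gv_entry_def)
    qed (use that in \<open>auto intro: lower upper\<close>)
  qed
  then show ?thesis unfolding gv_mat_def by (intro cong_mat refl) auto
qed

text \<open>
  Where \<open>x\<close> vanishes, the bound forces \<open>y\<close> to vanish as well, so that any coefficient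
  will do.
\<close>

lemma relative_coefficients:
  fixes x y :: "nat \<Rightarrow> real"
  assumes "0 < \<eta>" "\<And>i. i \<in> I \<Longrightarrow> \<bar>y i\<bar> \<le> \<eta> * \<bar>x i\<bar>"
  obtains e where "\<And>i. \<bar>e i\<bar> \<le> 1" "\<And>i. i \<in> I \<Longrightarrow> y i = \<eta> * e i * x i"
proof
  fix i
  show "\<bar>if i \<in> I then y i / (\<eta> * x i) else 0\<bar> \<le> 1"
  proof (cases "i \<in> I \<and> x i \<noteq> 0")
    case True
    then have "\<bar>y i\<bar> / (\<eta> * \<bar>x i\<bar>) \<le> 1" using assms(1) assms(2)[of i] by (simp add: divide_le_eq_1)
    then show ?thesis using True assms(1) by (simp add: abs_mult)
  qed auto
  show "y i = \<eta> * (if i \<in> I then y i / (\<eta> * x i) else 0) * x i" if "i \<in> I"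
    using that assms(1) assms(2)[OF that] by (cases "x i = 0") auto
qed

lemma gv_rel_complete:
  assumes "0 < \<eta>" and small: "gv_small n \<eta> \<Omega> \<Delta>"
  obtains e where "unit_gv e" "gv_mat n (gv_add \<Omega> \<Delta>) = gv_mat n (gv_add \<Omega> (gv_rel \<eta> e \<Omega>))"
proof -
  note s = small[unfolded gv_small_def]
  obtain l where l: "\<And>i. \<bar>l i\<bar> \<le> 1" "\<And>i. i \<in> {2..n-1} \<Longrightarrow> gv_l \<Delta> i = \<eta> * l i * gv_l \<Omega> i"
    using relative_coefficients[OF assms(1), of "{2..n-1}" "gv_l \<Delta>" "gv_l \<Omega>"] s by blast
  obtain u where u: "\<And>i. \<bar>u i\<bar> \<le> 1" "\<And>i. i \<in> {2..n-1} \<Longrightarrow> gv_u \<Delta> i = \<eta> * u i * gv_u \<Omega> i"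
    using relative_coefficients[OF assms(1), of "{2..n-1}" "gv_u \<Delta>" "gv_u \<Omega>"] s by blast
  obtain v where v: "\<And>i. \<bar>v i\<bar> \<le> 1" "\<And>i. i \<in> {1..n-1} \<Longrightarrow> gv_v \<Delta> i = \<eta> * v i * gv_v \<Omega> i"
    using relative_coefficients[OF assms(1), of "{1..n-1}" "gv_v \<Delta>" "gv_v \<Omega>"] s by blast
  obtain w where w: "\<And>i. \<bar>w i\<bar> \<le> 1" "\<And>i. i \<in> {1..n-1} \<Longrightarrow> gv_w \<Delta> i = \<eta> * w i * gv_w \<Omega> i"
    using relative_coefficients[OF assms(1), of "{1..n-1}" "gv_w \<Delta>" "gv_w \<Omega>"] s by blast
  obtain d where d: "\<And>i. \<bar>d i\<bar> \<le> 1" "\<And>i. i \<in> {1..n} \<Longrightarrow> gv_d \<Delta> i = \<eta> * d i * gv_d \<Omega> i"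
    using relative_coefficients[OF assms(1), of "{1..n}" "gv_d \<Delta>" "gv_d \<Omega>"] s by blast
  show ?thesis
  proof (rule that[of "GV l v d w u"])
    show "unit_gv (GV l v d w u)"
      using l(1) u(1) v(1) w(1) d(1) by (simp add: unit_gv_def)
    show "gv_mat n (gv_add \<Omega> \<Delta>) = gv_mat n (gv_add \<Omega> (gv_rel \<eta> (GV l v d w u) \<Omega>))"
      unfolding gv_add_def gv_rel_def
    proof (rule gv_mat_cong)
    qed (simp_all add: l(2) u(2) v(2) w(2) d(2))
  qed
qed

lemma gv_small_gv_rel:
  assumes "0 < \<eta>" "unit_gv e"
  shows "gv_small n \<eta> \<Omega> (gv_rel \<eta> e \<Omega>)"
proof -
  have "\<bar>\<eta> * y * x\<bar> \<le> \<eta> * \<bar>x\<bar>" if "\<bar>y\<bar> \<le> 1" for x y :: real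
  proof -
    have "\<bar>y\<bar> * \<bar>x\<bar> \<le> 1 * \<bar>x\<bar>" using that by (intro mult_right_mono) simp_all
    then show ?thesis using \<open>0 < \<eta>\<close> by (simp add: abs_mult mult.assoc)
  qed
  then show ?thesis
    using assms(2) by (simp add: gv_small_def gv_rel_def unit_gv_def)
qed

section \<open>The condition number as the norm of a sensitivity matrix\<close>

lemma sparse_mat_carrier: "sparse_mat n m M S \<omega> \<in> carrier_mat n m"
  by (simp add: sparse_mat_def)

lemma gv_mat_carrier: "gv_mat n \<Omega> \<in> carrier_mat n n"
  by (simp add: gv_mat_def)

locale gv_system =
  fixes n m M :: nat and S :: "nat \<Rightarrow> real mat" and \<Omega> :: gv_params and \<omega> :: "nat \<Rightarrow> real" and X Y :: "real mat"
  assumes n: "0 < n" and m: "0 < m"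
    and S: "\<And>k. k \<in> {1..M} \<Longrightarrow> S k \<in> carrier_mat n m"
    and X: "X \<in> carrier_mat n m" and Y: "Y \<in> carrier_mat n n"
    and YA: "Y * gv_mat n \<Omega> = 1\<^sub>m n"
    and AX: "gv_mat n \<Omega> * X = sparse_mat n m M S \<omega>"
    and X_pos: "0 < max_norm X"
begin

text \<open>
  The array \<open>\<alpha>\<close> belonging to the solution entry \<open>(r, c)\<close>: the effect on this entry,
  up to sign and to first order, of changing \<open>A\<^sub>i\<^sub>j\<close> at relative rate 1.
\<close>

definition weight :: "nat \<Rightarrow> nat \<Rightarrow> nat \<Rightarrow> nat \<Rightarrow> real" where
  "weight r c i j = Y $$ (r, i) * gv_mat n \<Omega> $$ (i, j) * X $$ (j, c)"

definition sensitivity :: "real mat" where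
  "sensitivity = mat n m (\<lambda>(r, c). (\<Sum>k=1..M. \<bar>\<omega> k * (Y * S k) $$ (r, c)\<bar>) + gv_sensitivity n \<Omega> (weight r c))"

definition perturbed :: "real \<Rightarrow> gv_params \<Rightarrow> real mat" where
  "perturbed \<eta> e = gv_mat n (gv_add \<Omega> (gv_rel \<eta> e \<Omega>))"

text \<open>
  Multiplying the perturbed matrix by \<open>Y\<close> gives the identity plus this matrix.
\<close>

definition drift :: "real \<Rightarrow> gv_params \<Rightarrow> real mat" where
  "drift \<eta> e = Y * (perturbed \<eta> e - gv_mat n \<Omega>)"

text \<open>
  The first condition allows the second-order term to be absorbed; the second says that the
  logarithmic derivatives predict the first-order term up to an error of \<open>\<tau> \<eta>\<close>.
\<close>

definition linear_regime :: "real \<Rightarrow> real \<Rightarrow> bool" where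
  "linear_regime \<tau> \<eta> \<longleftrightarrow> (\<forall>e. unit_gv e \<longrightarrow>
     (\<forall>i<n. (\<Sum>k<n. \<bar>drift \<eta> e $$ (i, k)\<bar>) \<le> \<tau>) \<and>
     (\<forall>r<n. \<forall>c<m. \<bar>(drift \<eta> e * X) $$ (r, c) / \<eta> - (\<Sum>i<n. \<Sum>j<n. weight r c i j * gv_rate n \<Omega> e i j)\<bar> \<le> \<tau>))"

lemma linear_regimeD:
  assumes "linear_regime \<tau> \<eta>" "unit_gv e"
  shows "i < n \<Longrightarrow> (\<Sum>k<n. \<bar>drift \<eta> e $$ (i, k)\<bar>) \<le> \<tau>"
    and "r < n \<Longrightarrow> c < m \<Longrightarrow>
      \<bar>(drift \<eta> e * X) $$ (r, c) / \<eta> - (\<Sum>i<n. \<Sum>j<n. weight r c i j * gv_rate n \<Omega> e i j)\<bar> \<le> \<tau>"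
  using assms(1)[unfolded linear_regime_def, rule_format, OF assms(2)] by blast+

lemma perturbed_carrier: "perturbed \<eta> e \<in> carrier_mat n n"
  by (simp add: perturbed_def gv_mat_carrier)

lemma difference_carrier: "perturbed \<eta> e - gv_mat n \<Omega> \<in> carrier_mat n n"
  by (rule minus_carrier_mat[OF gv_mat_carrier])

lemma drift_carrier: "drift \<eta> e \<in> carrier_mat n n"
  unfolding drift_def by (rule mult_carrier_mat[OF Y difference_carrier])

lemma perturbed_entry_expansion:
  assumes "i < n" "j < n"
  shows "relative_expansion perturbations fst (\<lambda>p. perturbed (fst p) (snd p) $$ (i, j))
    (gv_mat n \<Omega> $$ (i, j)) (\<lambda>p. gv_rate n \<Omega> (snd p) i j)"
  using relative_expansion_gv_entry[of n \<Omega> i j] assms by (simp add: perturbed_def gv_mat_def)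

lemma difference_entry:
  assumes "i < n" "j < n"
  shows "(perturbed \<eta> e - gv_mat n \<Omega>) $$ (i, j) = perturbed \<eta> e $$ (i, j) - gv_mat n \<Omega> $$ (i, j)"
  using assms gv_mat_carrier[of n \<Omega>] by (intro index_minus_mat(1)) auto

lemma drift_row_tendsto_zero:
  assumes "i < n"
  shows "((\<lambda>p. \<Sum>k<n. \<bar>drift (fst p) (snd p) $$ (i, k)\<bar>) \<longlongrightarrow> 0) perturbations"
proof -
  have "drift (fst p) (snd p) $$ (i, k)
      = (\<Sum>l<n. Y $$ (i, l) * (perturbed (fst p) (snd p) $$ (l, k) - gv_mat n \<Omega> $$ (l, k)))"
    if "k < n" for k p
    unfolding drift_def mult_mat_entry[OF Y difference_carrier assms that]
    using that by (intro sum.cong refl) (simp only: difference_entry lessThan_iff)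
  moreover have "((\<lambda>p. \<Sum>k<n. \<bar>\<Sum>l<n. Y $$ (i, l) * (perturbed (fst p) (snd p) $$ (l, k) - gv_mat n \<Omega> $$ (l, k))\<bar>)
      \<longlongrightarrow> 0) perturbations"
    using relative_expansion_tendsto[OF filterlim_fst_perturbations perturbed_entry_expansion]
    by (intro tendsto_null_sum tendsto_rabs_zero tendsto_mult_right_zero LIM_zero) auto
  ultimately show ?thesis by simp
qed

lemma drift_solution_tendsto:
  assumes "r < n" "c < m"
  shows "((\<lambda>p. (drift (fst p) (snd p) * X) $$ (r, c) / fst p
    - (\<Sum>i<n. \<Sum>j<n. weight r c i j * gv_rate n \<Omega> (snd p) i j)) \<longlongrightarrow> 0) perturbations"
proof -
  let ?d = "\<lambda>p i j. (perturbed (fst p) (snd p) $$ (i, j) - gv_mat n \<Omega> $$ (i, j)) / fst p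
    - gv_mat n \<Omega> $$ (i, j) * gv_rate n \<Omega> (snd p) i j"
  have "(drift (fst p) (snd p) * X) $$ (r, c)
      = (\<Sum>i<n. \<Sum>j<n. Y $$ (r, i) * (perturbed (fst p) (snd p) $$ (i, j) - gv_mat n \<Omega> $$ (i, j)) * X $$ (j, c))" for p
    unfolding drift_def mult_mat3_entry[OF Y difference_carrier X assms]
    by (intro sum.cong refl) (simp only: difference_entry lessThan_iff)
  note eq = this
  have "(drift (fst p) (snd p) * X) $$ (r, c) / fst p
      - (\<Sum>i<n. \<Sum>j<n. weight r c i j * gv_rate n \<Omega> (snd p) i j)
      = (\<Sum>i<n. \<Sum>j<n. (Y $$ (r, i) * X $$ (j, c)) * ?d p i j)" for p
    unfolding eq sum_divide_distrib weight_def sum_subtractf[symmetric]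
    by (intro sum.cong refl) (simp add: algebra_simps diff_divide_distrib)
  moreover have "((\<lambda>p. \<Sum>i<n. \<Sum>j<n. (Y $$ (r, i) * X $$ (j, c)) * ?d p i j) \<longlongrightarrow> 0) perturbations"
    using perturbed_entry_expansion unfolding relative_expansion_def
    by (intro tendsto_null_sum tendsto_mult_right_zero) auto
  ultimately show ?thesis by simp
qed

lemma eventually_linear_regime:
  assumes "0 < \<tau>"
  shows "eventually (linear_regime \<tau>) (at_right 0)"
proof -
  have small: "eventually (\<lambda>p. \<bar>f p\<bar> \<le> \<tau>) perturbations" if "(f \<longlongrightarrow> 0) perturbations" for f :: "_ \<Rightarrow> real"
    using tendstoD[OF that assms] by (rule eventually_mono) simp
  have "eventually (\<lambda>p. \<forall>i\<in>{..<n}. \<bar>\<Sum>k<n. \<bar>drift (fst p) (snd p) $$ (i, k)\<bar>\<bar> \<le> \<tau>) perturbations"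
    by (intro eventually_ball_finite ballI small drift_row_tendsto_zero) auto
  moreover have "eventually (\<lambda>p. \<forall>r\<in>{..<n}. \<forall>c\<in>{..<m}. \<bar>(drift (fst p) (snd p) * X) $$ (r, c) / fst p
      - (\<Sum>i<n. \<Sum>j<n. weight r c i j * gv_rate n \<Omega> (snd p) i j)\<bar> \<le> \<tau>) perturbations"
    by (intro eventually_ball_finite ballI small drift_solution_tendsto) auto
  ultimately have "eventually (\<lambda>p. (\<forall>i<n. (\<Sum>k<n. \<bar>drift (fst p) (snd p) $$ (i, k)\<bar>) \<le> \<tau>) \<and>
     (\<forall>r<n. \<forall>c<m. \<bar>(drift (fst p) (snd p) * X) $$ (r, c) / fst p
       - (\<Sum>i<n. \<Sum>j<n. weight r c i j * gv_rate n \<Omega> (snd p) i j)\<bar> \<le> \<tau>)) perturbations"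
    by eventually_elim (simp add: abs_of_nonneg sum_nonneg)
  then show ?thesis
    unfolding eventually_perturbations linear_regime_def by simp
qed

abbreviation (input) rhs_change :: "(nat \<Rightarrow> real) \<Rightarrow> real mat" where
  "rhs_change \<delta> \<equiv> sparse_mat n m M S (\<lambda>k. \<omega> k + \<delta> k) - sparse_mat n m M S \<omega>"

text \<open>
  Everything in the equation for \<open>\<delta>X\<close> except \<open>\<delta>X\<close> itself and its product with the
  drift; see \<open>perturbed_solution\<close>.
\<close>

definition residual :: "real \<Rightarrow> gv_params \<Rightarrow> (nat \<Rightarrow> real) \<Rightarrow> real mat" where
  "residual \<eta> e \<delta> = Y * rhs_change \<delta> - drift \<eta> e * X"

lemma residual_carrier: "residual \<eta> e \<delta> \<in> carrier_mat n m"
  unfolding residual_def by (intro minus_carrier_mat mult_carrier_mat[OF drift_carrier X])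

lemma residual_entry:
  assumes "r < n" "c < m"
  shows "residual \<eta> e \<delta> $$ (r, c) = (\<Sum>k=1..M. \<delta> k * (Y * S k) $$ (r, c)) - (drift \<eta> e * X) $$ (r, c)"
proof -
  have R: "rhs_change \<delta> \<in> carrier_mat n m" by (intro minus_carrier_mat sparse_mat_carrier)
  have "rhs_change \<delta> $$ (i, c) = (\<Sum>k=1..M. \<delta> k * S k $$ (i, c))" if "i < n" for i
    using that assms(2) by (simp add: sparse_mat_def distrib_right sum.distrib)
  then have "(Y * rhs_change \<delta>) $$ (r, c) = (\<Sum>i<n. \<Sum>k=1..M. Y $$ (r, i) * (\<delta> k * S k $$ (i, c)))"
    unfolding mult_mat_entry[OF Y R assms] by (simp add: sum_distrib_left)
  also have "\<dots> = (\<Sum>k=1..M. \<delta> k * (\<Sum>i<n. Y $$ (r, i) * S k $$ (i, c)))"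
    by (subst sum.swap) (simp add: sum_distrib_left mult.left_commute)
  also have "\<dots> = (\<Sum>k=1..M. \<delta> k * (Y * S k) $$ (r, c))"
    using assms by (intro sum.cong refl) (simp only: mult_mat_entry[OF Y S])
  finally show ?thesis
    using assms carrier_matD[OF drift_carrier[of \<eta> e]] carrier_matD[OF X]
    unfolding residual_def by (subst index_minus_mat(1)) simp_all
qed

lemma perturbed_solution:
  assumes D: "D \<in> carrier_mat n m"
    and eq: "perturbed \<eta> e * (X + D) = sparse_mat n m M S (\<lambda>k. \<omega> k + \<delta> k)"
  shows "D + drift \<eta> e * D = residual \<eta> e \<delta>"
proof -
  have XD: "X + D \<in> carrier_mat n m" using X D by simp
  have "Y * sparse_mat n m M S (\<lambda>k. \<omega> k + \<delta> k) = X + D + drift \<eta> e * (X + D)"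
    unfolding eq[symmetric] drift_def
    by (rule left_inverse_mult_perturbed[OF gv_mat_carrier perturbed_carrier Y XD YA])
  also have "drift \<eta> e * (X + D) = drift \<eta> e * X + drift \<eta> e * D"
    by (rule mult_add_distrib_mat[OF drift_carrier X D])
  finally have 1: "Y * sparse_mat n m M S (\<lambda>k. \<omega> k + \<delta> k) = X + D + (drift \<eta> e * X + drift \<eta> e * D)" .
  have 2: "Y * sparse_mat n m M S \<omega> = X"
    using assoc_mult_mat[OF Y gv_mat_carrier[of n \<Omega>] X] YA X unfolding AX[symmetric] by simp
  have "D + Q = X + D + (P + Q) - X - P" if "P \<in> carrier_mat n m" "Q \<in> carrier_mat n m" for P Q
    using X D that by (intro eq_matI) auto
  from this[OF mult_carrier_mat[OF drift_carrier X] mult_carrier_mat[OF drift_carrier D]] show ?thesis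
    unfolding residual_def mult_minus_distrib_mat[OF Y sparse_mat_carrier sparse_mat_carrier] 1 2 .
qed

lemma sensitivity_entry:
  assumes "r < n" "c < m"
  shows "sensitivity $$ (r, c) = (\<Sum>k=1..M. \<bar>\<omega> k * (Y * S k) $$ (r, c)\<bar>) + gv_sensitivity n \<Omega> (weight r c)"
  unfolding sensitivity_def using assms by (simp only: index_mat prod.case)

lemma abs_residual_le:
  assumes "linear_regime \<tau> \<eta>" "0 < \<eta>" "unit_gv e" and \<delta>: "\<forall>k\<in>{1..M}. \<bar>\<delta> k\<bar> \<le> \<eta> * \<bar>\<omega> k\<bar>" and rc: "r < n" "c < m"
  shows "\<bar>residual \<eta> e \<delta> $$ (r, c)\<bar> \<le> \<eta> * (sensitivity $$ (r, c) + \<tau>)"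
proof -
  have "\<bar>\<Sum>k=1..M. \<delta> k * (Y * S k) $$ (r, c)\<bar> \<le> (\<Sum>k=1..M. \<eta> * \<bar>\<omega> k * (Y * S k) $$ (r, c)\<bar>)"
  proof (intro order_trans[OF sum_abs] sum_mono)
    fix k assume "k \<in> {1..M}"
    then have "\<bar>\<delta> k\<bar> * \<bar>(Y * S k) $$ (r, c)\<bar> \<le> \<eta> * \<bar>\<omega> k\<bar> * \<bar>(Y * S k) $$ (r, c)\<bar>"
      using \<delta> by (intro mult_right_mono) auto
    then show "\<bar>\<delta> k * (Y * S k) $$ (r, c)\<bar> \<le> \<eta> * \<bar>\<omega> k * (Y * S k) $$ (r, c)\<bar>"
      by (simp only: abs_mult mult.assoc)
  qed
  then have 1: "\<bar>\<Sum>k=1..M. \<delta> k * (Y * S k) $$ (r, c)\<bar> \<le> \<eta> * (\<Sum>k=1..M. \<bar>\<omega> k * (Y * S k) $$ (r, c)\<bar>)"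
    by (simp only: sum_distrib_left)
  have "\<bar>(drift \<eta> e * X) $$ (r, c) / \<eta> - (\<Sum>i<n. \<Sum>j<n. weight r c i j * gv_rate n \<Omega> e i j)\<bar> \<le> \<tau>"
    by (rule linear_regimeD(2)[OF assms(1,3) rc])
  then have "\<bar>(drift \<eta> e * X) $$ (r, c) / \<eta>\<bar> \<le> gv_sensitivity n \<Omega> (weight r c) + \<tau>"
    using sum_gv_rate_le[OF \<open>unit_gv e\<close>, of "weight r c" n \<Omega>] by linarith
  then have "\<bar>(drift \<eta> e * X) $$ (r, c)\<bar> \<le> \<eta> * (gv_sensitivity n \<Omega> (weight r c) + \<tau>)"
    using \<open>0 < \<eta>\<close> by (simp add: pos_divide_le_eq mult.commute)
  then have "\<bar>residual \<eta> e \<delta> $$ (r, c)\<bar> \<le> \<eta> * (\<Sum>k=1..M. \<bar>\<omega> k * (Y * S k) $$ (r, c)\<bar>)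
      + \<eta> * (gv_sensitivity n \<Omega> (weight r c) + \<tau>)"
    unfolding residual_entry[OF rc] using 1 by linarith
  then show ?thesis
    unfolding sensitivity_entry[OF rc] by (simp only: distrib_left add.assoc)
qed

text \<open>
  The perturbations of the right-hand side and of the matrix are chosen independently, so both can be
  made to push the entry \<open>(r, c)\<close> in the same direction, here downwards.
\<close>

lemma residual_attained:
  assumes "linear_regime \<tau> \<eta>" "0 < \<eta>" and rc: "r < n" "c < m"
  obtains e \<delta> where "unit_gv e" "\<forall>k\<in>{1..M}. \<bar>\<delta> k\<bar> \<le> \<eta> * \<bar>\<omega> k\<bar>"
    "\<eta> * (sensitivity $$ (r, c) - \<tau>) \<le> \<bar>residual \<eta> e \<delta> $$ (r, c)\<bar>"
proof -
  obtain e where e: "unit_gv e"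
      "(\<Sum>i<n. \<Sum>j<n. weight r c i j * gv_rate n \<Omega> e i j) = gv_sensitivity n \<Omega> (weight r c)"
    by (rule sum_gv_rate_attained)
  define \<delta> where "\<delta> k = - \<eta> * sgn (\<omega> k * (Y * S k) $$ (r, c)) * \<omega> k" for k
  show ?thesis
  proof (rule that)
    show "unit_gv e" by (rule e(1))
    show "\<forall>k\<in>{1..M}. \<bar>\<delta> k\<bar> \<le> \<eta> * \<bar>\<omega> k\<bar>"
    proof
      fix k
      have "\<bar>- \<eta> * sgn y * x\<bar> \<le> \<eta> * \<bar>x\<bar>" for x y :: real
        using \<open>0 < \<eta>\<close> by (simp add: abs_mult abs_sgn_eq)
      then show "\<bar>\<delta> k\<bar> \<le> \<eta> * \<bar>\<omega> k\<bar>" unfolding \<delta>_def .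
    qed
    have "- \<eta> * sgn (x * y) * x * y = - \<eta> * \<bar>x * y\<bar>" for x y :: real
      using abs_sgn[of "x * y"] by (simp add: mult_ac)
    then have "\<delta> k * (Y * S k) $$ (r, c) = - \<eta> * \<bar>\<omega> k * (Y * S k) $$ (r, c)\<bar>" for k
      unfolding \<delta>_def .
    then have 1: "(\<Sum>k=1..M. \<delta> k * (Y * S k) $$ (r, c)) = - \<eta> * (\<Sum>k=1..M. \<bar>\<omega> k * (Y * S k) $$ (r, c)\<bar>)"
      by (simp only: sum_distrib_left)
    have combine: "\<eta> * (b + g - \<tau>) \<le> - (- \<eta> * b - d)" if "\<eta> * (g - \<tau>) \<le> d" for b g d
      using that by (simp add: algebra_simps)
    have "\<bar>(drift \<eta> e * X) $$ (r, c) / \<eta> - gv_sensitivity n \<Omega> (weight r c)\<bar> \<le> \<tau>"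
      using linear_regimeD(2)[OF assms(1) e(1) rc] unfolding e(2) .
    then have "gv_sensitivity n \<Omega> (weight r c) - \<tau> \<le> (drift \<eta> e * X) $$ (r, c) / \<eta>"
      by linarith
    then have "\<eta> * (gv_sensitivity n \<Omega> (weight r c) - \<tau>) \<le> (drift \<eta> e * X) $$ (r, c)"
      using \<open>0 < \<eta>\<close> by (simp only: pos_le_divide_eq mult.commute)
    then have "\<eta> * (sensitivity $$ (r, c) - \<tau>) \<le> - residual \<eta> e \<delta> $$ (r, c)"
      unfolding residual_entry[OF rc] 1 sensitivity_entry[OF rc] by (rule combine)
    then show "\<eta> * (sensitivity $$ (r, c) - \<tau>) \<le> \<bar>residual \<eta> e \<delta> $$ (r, c)\<bar>"
      by linarith
  qed
qed

lemma sensitivity_carrier: "sensitivity \<in> carrier_mat n m"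
  by (simp add: sensitivity_def)

text \<open>
  Every \<open>\<delta>X\<close> satisfies \<open>\<parallel>\<delta>X\<parallel> \<le> \<parallel>residual\<parallel> + \<tau> \<parallel>\<delta>X\<parallel>\<close>, and the
  entries of the residual are at most \<open>\<eta> (\<parallel>sensitivity\<parallel> + \<tau>)\<close>.
\<close>

lemma growth_upper:
  assumes lin: "linear_regime \<tau> \<eta>" and "0 < \<eta>" "0 < \<tau>" "\<tau> < 1"
  shows "gv_growth n m M S \<Omega> \<omega> X \<eta> \<le> ereal ((max_norm sensitivity + \<tau>) / (1 - \<tau>) / max_norm X)"
  unfolding gv_growth_def
proof (rule Sup_least, clarify)
  fix D \<Delta> \<delta>
  assume D: "D \<in> carrier_mat n m" and small: "gv_small n \<eta> \<Omega> \<Delta>" "\<forall>k\<in>{1..M}. \<bar>\<delta> k\<bar> \<le> \<eta> * \<bar>\<omega> k\<bar>"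
    and eq: "gv_mat n (gv_add \<Omega> \<Delta>) * (X + D) = sparse_mat n m M S (\<lambda>k. \<omega> k + \<delta> k)"
  obtain e where e: "unit_gv e" "gv_mat n (gv_add \<Omega> \<Delta>) = perturbed \<eta> e"
    using gv_rel_complete[OF \<open>0 < \<eta>\<close> small(1)] unfolding perturbed_def by blast
  note sol = perturbed_solution[OF D eq[unfolded e(2)]]
  have "max_norm (residual \<eta> e \<delta>) \<le> \<eta> * (max_norm sensitivity + \<tau>)"
  proof (rule max_norm_le[OF residual_carrier n m])
    fix r c assume rc: "r < n" "c < m"
    have "\<eta> * (sensitivity $$ (r, c) + \<tau>) \<le> \<eta> * (max_norm sensitivity + \<tau>)"
      using abs_entry_le_max_norm[OF sensitivity_carrier rc] \<open>0 < \<eta>\<close> by (intro mult_left_mono) linarith+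
    then show "\<bar>residual \<eta> e \<delta> $$ (r, c)\<bar> \<le> \<eta> * (max_norm sensitivity + \<tau>)"
      using abs_residual_le[OF lin \<open>0 < \<eta>\<close> e(1) small(2) rc] by linarith
  qed
  moreover have "max_norm D \<le> max_norm (residual \<eta> e \<delta>) + \<tau> * max_norm D"
    using linear_regimeD(1)[OF lin e(1)] by (rule perturbed_identity_bounds(1)[OF drift_carrier D n m _ sol])
  ultimately have "max_norm D * (1 - \<tau>) \<le> \<eta> * (max_norm sensitivity + \<tau>)"
    by (simp add: algebra_simps)
  then have "max_norm D \<le> \<eta> * ((max_norm sensitivity + \<tau>) / (1 - \<tau>))"
    using \<open>\<tau> < 1\<close> by (simp add: pos_le_divide_eq)
  then have "max_norm D / \<eta> \<le> (max_norm sensitivity + \<tau>) / (1 - \<tau>)"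
    using \<open>0 < \<eta>\<close> by (simp add: pos_divide_le_eq mult.commute)
  then have "max_norm D / \<eta> / max_norm X \<le> (max_norm sensitivity + \<tau>) / (1 - \<tau>) / max_norm X"
    using X_pos by (intro divide_right_mono) simp_all
  then show "ereal (1 / \<eta> * (max_norm D / max_norm X)) \<le> ereal ((max_norm sensitivity + \<tau>) / (1 - \<tau>) / max_norm X)"
    by simp
qed

text \<open>
  At the largest entry of the sensitivity matrix the residual is almost \<open>\<eta>\<close> times that entry
  for one perturbation. As \<open>\<tau> < 1\<close>, the perturbed system has a solution, which thus enters the
  supremum.
\<close>

lemma growth_lower:
  assumes lin: "linear_regime \<tau> \<eta>" and "0 < \<eta>" "0 < \<tau>" "\<tau> < 1"
  shows "ereal ((max_norm sensitivity - \<tau>) / (1 + \<tau>) / max_norm X) \<le> gv_growth n m M S \<Omega> \<omega> X \<eta>"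
proof -
  obtain r c where rc: "r < n" "c < m" and max: "max_norm sensitivity = \<bar>sensitivity $$ (r, c)\<bar>"
    by (rule max_norm_attained[OF sensitivity_carrier n m])
  have "0 \<le> sensitivity $$ (r, c)"
    using rc by (simp add: sensitivity_def gv_sensitivity_def chain_sensitivity_def sum_nonneg add_nonneg_nonneg)
  with max have max: "max_norm sensitivity = sensitivity $$ (r, c)" by simp
  obtain e \<delta> where e: "unit_gv e" and \<delta>: "\<forall>k\<in>{1..M}. \<bar>\<delta> k\<bar> \<le> \<eta> * \<bar>\<omega> k\<bar>"
    and large: "\<eta> * (max_norm sensitivity - \<tau>) \<le> \<bar>residual \<eta> e \<delta> $$ (r, c)\<bar>"
    using residual_attained[OF lin \<open>0 < \<eta>\<close> rc] unfolding max by blast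
  have row: "(\<Sum>k<n. \<bar>drift \<eta> e $$ (i, k)\<bar>) \<le> \<tau>" if "i < n" for i
    using linear_regimeD(1)[OF lin e that] .
  obtain Z where Z: "Z \<in> carrier_mat n m" "perturbed \<eta> e * Z = sparse_mat n m M S (\<lambda>k. \<omega> k + \<delta> k)"
    by (rule perturbed_system_solvable[OF gv_mat_carrier perturbed_carrier Y YA n sparse_mat_carrier
          row[unfolded drift_def] \<open>\<tau> < 1\<close>])
  define D where "D = Z - X"
  have D: "D \<in> carrier_mat n m" unfolding D_def by (rule minus_carrier_mat[OF X])
  have "X + D = Z" using X Z(1) unfolding D_def by (intro eq_matI) auto
  with Z(2) have eq: "perturbed \<eta> e * (X + D) = sparse_mat n m M S (\<lambda>k. \<omega> k + \<delta> k)" by simp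
  have "\<eta> * (max_norm sensitivity - \<tau>) \<le> (1 + \<tau>) * max_norm D"
    using large abs_entry_le_max_norm[OF residual_carrier rc, of \<eta> e \<delta>]
      perturbed_identity_bounds(2)[OF drift_carrier D n m row perturbed_solution[OF D eq]] by linarith
  then have "(max_norm sensitivity - \<tau>) / (1 + \<tau>) \<le> max_norm D / \<eta>"
    using \<open>0 < \<eta>\<close> \<open>0 < \<tau>\<close> by (simp add: field_simps)
  then have "(max_norm sensitivity - \<tau>) / (1 + \<tau>) / max_norm X \<le> max_norm D / \<eta> / max_norm X"
    using X_pos by (intro divide_right_mono) simp_all
  then have "ereal ((max_norm sensitivity - \<tau>) / (1 + \<tau>) / max_norm X) \<le> ereal (1 / \<eta> * (max_norm D / max_norm X))"
    by simp
  also have "\<dots> \<le> gv_growth n m M S \<Omega> \<omega> X \<eta>"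
    unfolding gv_growth_def
  proof (intro Sup_upper CollectI exI[of _ D] exI[of _ "gv_rel \<eta> e \<Omega>"] exI[of _ \<delta>] conjI refl)
    show "gv_mat n (gv_add \<Omega> (gv_rel \<eta> e \<Omega>)) * (X + D) = sparse_mat n m M S (\<lambda>k. \<omega> k + \<delta> k)"
      using eq unfolding perturbed_def .
  qed (fact D \<delta> gv_small_gv_rel[OF \<open>0 < \<eta>\<close> e])+
  finally show ?thesis .
qed

lemma growth_tendsto:
  "(gv_growth n m M S \<Omega> \<omega> X \<longlongrightarrow> ereal (max_norm sensitivity / max_norm X)) (at_right 0)"
proof -
  define lo where "lo \<tau> = (max_norm sensitivity - \<tau>) / (1 + \<tau>) / max_norm X" for \<tau>
  define up where "up \<tau> = (max_norm sensitivity + \<tau>) / (1 - \<tau>) / max_norm X" for \<tau>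
  have "(lo \<longlongrightarrow> (max_norm sensitivity - 0) / (1 + 0) / max_norm X) (at_right 0)"
    unfolding lo_def using X_pos by (intro tendsto_intros) simp_all
  then have lo: "((\<lambda>\<tau>. ereal (lo \<tau>)) \<longlongrightarrow> ereal (max_norm sensitivity / max_norm X)) (at_right 0)"
    by simp
  have "(up \<longlongrightarrow> (max_norm sensitivity + 0) / (1 - 0) / max_norm X) (at_right 0)"
    unfolding up_def using X_pos by (intro tendsto_intros) simp_all
  then have up: "((\<lambda>\<tau>. ereal (up \<tau>)) \<longlongrightarrow> ereal (max_norm sensitivity / max_norm X)) (at_right 0)"
    by simp
  have choose: "\<exists>\<tau>. P \<tau> \<and> 0 < \<tau> \<and> \<tau> < 1" if "eventually P (at_right 0)" for P :: "real \<Rightarrow> bool"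
  proof -
    have "eventually (\<lambda>\<tau>::real. 0 < \<tau> \<and> \<tau> < 1) (at_right 0)"
      by (rule eventually_at_rightI[of 0 1]) auto
    from eventually_happens'[OF trivial_limit_at_right_real eventually_conj[OF that this]] show ?thesis .
  qed
  show ?thesis
  proof (rule order_tendstoI)
    fix a
    assume "a < ereal (max_norm sensitivity / max_norm X)"
    from choose[OF order_tendstoD(1)[OF lo this]]
    obtain \<tau> where \<tau>: "a < ereal (lo \<tau>)" "0 < \<tau>" "\<tau> < 1" by blast
    show "eventually (\<lambda>\<eta>. a < gv_growth n m M S \<Omega> \<omega> X \<eta>) (at_right 0)"
      using eventually_linear_regime[OF \<tau>(2)] eventually_at_right_less[of 0]
    proof eventually_elim
      case (elim \<eta>)
      from growth_lower[OF elim \<tau>(2,3)] \<tau>(1) show ?case unfolding lo_def by (rule less_le_trans[rotated])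
    qed
  next
    fix a
    assume "ereal (max_norm sensitivity / max_norm X) < a"
    from choose[OF order_tendstoD(2)[OF up this]]
    obtain \<tau> where \<tau>: "ereal (up \<tau>) < a" "0 < \<tau>" "\<tau> < 1" by blast
    show "eventually (\<lambda>\<eta>. gv_growth n m M S \<Omega> \<omega> X \<eta> < a) (at_right 0)"
      using eventually_linear_regime[OF \<tau>(2)] eventually_at_right_less[of 0]
    proof eventually_elim
      case (elim \<eta>)
      from growth_upper[OF elim \<tau>(2,3)] \<tau>(1) show ?case unfolding up_def by (rule le_less_trans)
    qed
  qed
qed

lemma gv_cond_eq: "gv_cond n m M S \<Omega> \<omega> X = ereal (max_norm sensitivity / max_norm X)"
  unfolding gv_cond_def using growth_tendsto by (rule tendsto_Lim[OF trivial_limit_at_right_real])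

section \<open>Comparison with the effective condition number\<close>

definition eff_sensitivity :: "real mat" where
  "eff_sensitivity = (let A = gv_mat n \<Omega> in
     sparse_mat n m M (\<lambda>k. abs_mat (Y * S k)) (\<lambda>k. \<bar>\<omega> k\<bar>)
     + abs_mat Y * abs_mat (diag_part A) * abs_mat X
     + abs_mat Y * abs_mat (lower_part A * X)
     + abs_mat (Y * lower_part A) * abs_mat X
     + abs_mat Y * abs_mat (upper_part A * X)
     + abs_mat (Y * upper_part A) * abs_mat X)"

lemma part_carrier:
  "diag_part (gv_mat n \<Omega>) \<in> carrier_mat n n"
  "lower_part (gv_mat n \<Omega>) \<in> carrier_mat n n"
  "upper_part (gv_mat n \<Omega>) \<in> carrier_mat n n"
  by (simp_all add: diag_part_def lower_part_def upper_part_def gv_mat_def)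

lemma part_entry:
  assumes "i < n" "j < n"
  shows "diag_part (gv_mat n \<Omega>) $$ (i, j) = (if i = j then gv_mat n \<Omega> $$ (i, j) else 0)"
    and "lower_part (gv_mat n \<Omega>) $$ (i, j) = (if j < i then gv_mat n \<Omega> $$ (i, j) else 0)"
    and "upper_part (gv_mat n \<Omega>) $$ (i, j) = (if i < j then gv_mat n \<Omega> $$ (i, j) else 0)"
  using assms by (simp_all add: diag_part_def lower_part_def upper_part_def gv_mat_def)

lemma eff_rhs_entry:
  assumes rc: "r < n" "c < m"
  shows "sparse_mat n m M (\<lambda>k. abs_mat (Y * S k)) (\<lambda>k. \<bar>\<omega> k\<bar>) $$ (r, c)
    = (\<Sum>k=1..M. \<bar>\<omega> k * (Y * S k) $$ (r, c)\<bar>)"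
proof -
  have "abs_mat (Y * S k) $$ (r, c) = \<bar>(Y * S k) $$ (r, c)\<bar>" if "k \<in> {1..M}" for k
    unfolding abs_mat_def using mult_carrier_mat[OF Y S[OF that]] rc by (intro index_map_mat(1)) auto
  then show ?thesis
    using rc unfolding sparse_mat_def by (simp del: index_mult_mat add: abs_mult)
qed

lemma eff_diag_entry:
  assumes rc: "r < n" "c < m"
  shows "(abs_mat Y * abs_mat (diag_part (gv_mat n \<Omega>)) * abs_mat X) $$ (r, c) = (\<Sum>i<n. \<bar>weight r c i i\<bar>)"
proof -
  have carrier: "abs_mat Y \<in> carrier_mat n n" "abs_mat (diag_part (gv_mat n \<Omega>)) \<in> carrier_mat n n"
    "abs_mat X \<in> carrier_mat n m"
    using Y X part_carrier(1) by (auto simp: abs_mat_def)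
  have "(abs_mat Y * abs_mat (diag_part (gv_mat n \<Omega>)) * abs_mat X) $$ (r, c)
      = (\<Sum>i<n. \<Sum>j<n. if j = i then \<bar>weight r c i i\<bar> else 0)"
    unfolding mult_mat3_entry[OF carrier rc]
  proof (intro sum.cong refl)
    fix i j assume "i \<in> {..<n}" "j \<in> {..<n}"
    then have ij: "i < n" "j < n" by auto
    have "abs_mat Y $$ (r, i) = \<bar>Y $$ (r, i)\<bar>" "abs_mat X $$ (j, c) = \<bar>X $$ (j, c)\<bar>"
      "abs_mat (diag_part (gv_mat n \<Omega>)) $$ (i, j) = \<bar>diag_part (gv_mat n \<Omega>) $$ (i, j)\<bar>"
      using ij rc Y X part_carrier(1) by (simp_all add: abs_mat_def)
    then show "abs_mat Y $$ (r, i) * abs_mat (diag_part (gv_mat n \<Omega>)) $$ (i, j) * abs_mat X $$ (j, c)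
        = (if j = i then \<bar>weight r c i i\<bar> else 0)"
      by (simp add: part_entry(1)[OF ij] weight_def abs_mult)
  qed
  then show ?thesis by simp
qed

lemma eff_left_entry:
  assumes rc: "r < n" "c < m" and T: "T \<in> carrier_mat n n"
    and entry: "\<And>i j. i < n \<Longrightarrow> j < n \<Longrightarrow> T $$ (i, j) = (if P i j then gv_mat n \<Omega> $$ (i, j) else 0)"
  shows "(abs_mat Y * abs_mat (T * X)) $$ (r, c) = (\<Sum>i<n. \<bar>\<Sum>j<n. if P i j then weight r c i j else 0\<bar>)"
  unfolding mult_abs_mat_entry[OF Y mult_carrier_mat[OF T X] rc]
proof (intro sum.cong refl)
  fix i assume "i \<in> {..<n}"
  then have i: "i < n" by simp
  have "\<bar>Y $$ (r, i)\<bar> * \<bar>(T * X) $$ (i, c)\<bar> = \<bar>\<Sum>j<n. Y $$ (r, i) * (T $$ (i, j) * X $$ (j, c))\<bar>"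
    unfolding mult_mat_entry[OF T X i rc(2)] by (simp only: abs_mult sum_distrib_left[symmetric])
  also have "(\<Sum>j<n. Y $$ (r, i) * (T $$ (i, j) * X $$ (j, c))) = (\<Sum>j<n. if P i j then weight r c i j else 0)"
    by (intro sum.cong refl) (simp add: entry[OF i] weight_def)
  finally show "\<bar>Y $$ (r, i)\<bar> * \<bar>(T * X) $$ (i, c)\<bar> = \<bar>\<Sum>j<n. if P i j then weight r c i j else 0\<bar>" .
qed

lemma eff_right_entry:
  assumes rc: "r < n" "c < m" and T: "T \<in> carrier_mat n n"
    and entry: "\<And>i j. i < n \<Longrightarrow> j < n \<Longrightarrow> T $$ (i, j) = (if P i j then gv_mat n \<Omega> $$ (i, j) else 0)"
  shows "(abs_mat (Y * T) * abs_mat X) $$ (r, c) = (\<Sum>j<n. \<bar>\<Sum>i<n. if P i j then weight r c i j else 0\<bar>)"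
  unfolding mult_abs_mat_entry[OF mult_carrier_mat[OF Y T] X rc]
proof (intro sum.cong refl)
  fix j assume "j \<in> {..<n}"
  then have j: "j < n" by simp
  have "\<bar>(Y * T) $$ (r, j)\<bar> * \<bar>X $$ (j, c)\<bar> = \<bar>\<Sum>i<n. Y $$ (r, i) * T $$ (i, j) * X $$ (j, c)\<bar>"
    unfolding mult_mat_entry[OF Y T rc(1) j] by (simp only: abs_mult sum_distrib_right[symmetric])
  also have "(\<Sum>i<n. Y $$ (r, i) * T $$ (i, j) * X $$ (j, c)) = (\<Sum>i<n. if P i j then weight r c i j else 0)"
    by (intro sum.cong refl) (simp add: entry[OF _ j] weight_def)
  finally show "\<bar>(Y * T) $$ (r, j)\<bar> * \<bar>X $$ (j, c)\<bar> = \<bar>\<Sum>i<n. if P i j then weight r c i j else 0\<bar>" .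
qed

lemma eff_sensitivity_carrier: "eff_sensitivity \<in> carrier_mat n m"
  using Y X by (auto simp: eff_sensitivity_def Let_def sparse_mat_def abs_mat_def)

text \<open>
  The terms with \<open>A\<^sub>L X\<close> and \<open>Y A\<^sub>L\<close> are the absolute row and column sums of the weights
  below the diagonal. Above the diagonal the transposed weights are used, which exchanges rows and
  columns.
\<close>

lemma eff_sensitivity_entry:
  assumes rc: "r < n" "c < m"
  shows "eff_sensitivity $$ (r, c) = (\<Sum>k=1..M. \<bar>\<omega> k * (Y * S k) $$ (r, c)\<bar>) + (\<Sum>i<n. \<bar>weight r c i i\<bar>)
    + ((\<Sum>i<n. \<bar>row_sum (weight r c) i\<bar>) + (\<Sum>j<n. \<bar>col_sum n (weight r c) j\<bar>))
    + ((\<Sum>i<n. \<bar>row_sum (\<lambda>i j. weight r c j i) i\<bar>) + (\<Sum>j<n. \<bar>col_sum n (\<lambda>i j. weight r c j i) j\<bar>))"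
proof -
  let ?A = "gv_mat n \<Omega>"
  have row: "(\<Sum>i<n. \<bar>\<Sum>j<n. if j < i then \<alpha> i j else 0\<bar>) = (\<Sum>i<n. \<bar>row_sum \<alpha> i\<bar>)" for \<alpha>
    by (intro sum.cong refl arg_cong[of _ _ abs] row_sum_eq[symmetric]) simp
  have col: "(\<Sum>j<n. \<bar>\<Sum>i<n. if j < i then \<alpha> i j else 0\<bar>) = (\<Sum>j<n. \<bar>col_sum n \<alpha> j\<bar>)" for \<alpha>
    by (intro sum.cong refl arg_cong[of _ _ abs] col_sum_eq[symmetric]) simp
  have "(abs_mat Y * abs_mat (lower_part ?A * X)) $$ (r, c) = (\<Sum>i<n. \<bar>\<Sum>j<n. if j < i then weight r c i j else 0\<bar>)"
    by (rule eff_left_entry[OF rc part_carrier(2)]) (rule part_entry(2))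
  then have lX: "(abs_mat Y * abs_mat (lower_part ?A * X)) $$ (r, c) = (\<Sum>i<n. \<bar>row_sum (weight r c) i\<bar>)"
    unfolding row .
  have "(abs_mat (Y * lower_part ?A) * abs_mat X) $$ (r, c) = (\<Sum>j<n. \<bar>\<Sum>i<n. if j < i then weight r c i j else 0\<bar>)"
    by (rule eff_right_entry[OF rc part_carrier(2)]) (rule part_entry(2))
  then have Yl: "(abs_mat (Y * lower_part ?A) * abs_mat X) $$ (r, c) = (\<Sum>j<n. \<bar>col_sum n (weight r c) j\<bar>)"
    unfolding col .
  have "(abs_mat Y * abs_mat (upper_part ?A * X)) $$ (r, c) = (\<Sum>i<n. \<bar>\<Sum>j<n. if i < j then weight r c i j else 0\<bar>)"
    by (rule eff_left_entry[OF rc part_carrier(3)]) (rule part_entry(3))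
  then have uX: "(abs_mat Y * abs_mat (upper_part ?A * X)) $$ (r, c) = (\<Sum>j<n. \<bar>col_sum n (\<lambda>i j. weight r c j i) j\<bar>)"
    unfolding col[of "\<lambda>i j. weight r c j i"] .
  have "(abs_mat (Y * upper_part ?A) * abs_mat X) $$ (r, c) = (\<Sum>j<n. \<bar>\<Sum>i<n. if i < j then weight r c i j else 0\<bar>)"
    by (rule eff_right_entry[OF rc part_carrier(3)]) (rule part_entry(3))
  then have Yu: "(abs_mat (Y * upper_part ?A) * abs_mat X) $$ (r, c) = (\<Sum>i<n. \<bar>row_sum (\<lambda>i j. weight r c j i) i\<bar>)"
    unfolding row[of "\<lambda>i j. weight r c j i"] .
  have carrier: "abs_mat Z \<in> carrier_mat a b" if "Z \<in> carrier_mat a b" for Z a b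
    using that by (simp add: abs_mat_def)
  note carriers = sparse_mat_carrier[of n m M "\<lambda>k. abs_mat (Y * S k)" "\<lambda>k. \<bar>\<omega> k\<bar>"]
    mult_carrier_mat[OF mult_carrier_mat[OF carrier[OF Y] carrier[OF part_carrier(1)]] carrier[OF X]]
    mult_carrier_mat[OF carrier[OF Y] carrier[OF mult_carrier_mat[OF part_carrier(2) X]]]
    mult_carrier_mat[OF carrier[OF mult_carrier_mat[OF Y part_carrier(2)]] carrier[OF X]]
    mult_carrier_mat[OF carrier[OF Y] carrier[OF mult_carrier_mat[OF part_carrier(3) X]]]
    mult_carrier_mat[OF carrier[OF mult_carrier_mat[OF Y part_carrier(3)]] carrier[OF X]]
  have sum6: "(P1 + P2 + P3 + P4 + P5 + P6) $$ (r, c)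
      = P1 $$ (r, c) + P2 $$ (r, c) + P3 $$ (r, c) + P4 $$ (r, c) + P5 $$ (r, c) + P6 $$ (r, c)"
    if "P1 \<in> carrier_mat n m" "P2 \<in> carrier_mat n m" "P3 \<in> carrier_mat n m"
      "P4 \<in> carrier_mat n m" "P5 \<in> carrier_mat n m" "P6 \<in> carrier_mat n m" for P1 P2 P3 P4 P5 P6 :: "real mat"
    using that rc by simp
  show ?thesis
    unfolding eff_sensitivity_def Let_def sum6[OF carriers] lX Yl uX Yu eff_diag_entry[OF rc] eff_rhs_entry[OF rc]
    by linarith
qed

text \<open>
  The contributions of \<open>B\<close> and of the diagonal agree in both matrices, and both factors are at
  least 1; the two triangles are compared separately.
\<close>

lemma sensitivity_le:
  assumes "3 \<le> n" and rc: "r < n" "c < m"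
  shows "sensitivity $$ (r, c) \<le> (real n - 1) * eff_sensitivity $$ (r, c)"
    and "eff_sensitivity $$ (r, c) \<le> 3 * (real n - 2) * sensitivity $$ (r, c)"
    and "0 \<le> sensitivity $$ (r, c)" "0 \<le> eff_sensitivity $$ (r, c)"
proof -
  let ?l = "\<lambda>k. (givens_sin (gv_l \<Omega>) (Suc k))\<^sup>2" and ?u = "\<lambda>k. (givens_sin (gv_u \<Omega>) (Suc k))\<^sup>2"
  let ?\<alpha> = "weight r c" and ?\<alpha>' = "\<lambda>i j. weight r c j i"
  define b where "b = (\<Sum>k=1..M. \<bar>\<omega> k * (Y * S k) $$ (r, c)\<bar>) + (\<Sum>i<n. \<bar>weight r c i i\<bar>)"
  define L where "L = chain_sensitivity n ?l ?\<alpha>"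
  define U where "U = chain_sensitivity n ?u ?\<alpha>'"
  define eL where "eL = (\<Sum>i<n. \<bar>row_sum ?\<alpha> i\<bar>) + (\<Sum>j<n. \<bar>col_sum n ?\<alpha> j\<bar>)"
  define eU where "eU = (\<Sum>i<n. \<bar>row_sum ?\<alpha>' i\<bar>) + (\<Sum>j<n. \<bar>col_sum n ?\<alpha>' j\<bar>)"
  have s: "sensitivity $$ (r, c) = b + L + U"
    unfolding sensitivity_entry[OF rc] gv_sensitivity_def b_def L_def U_def by linarith
  have e: "eff_sensitivity $$ (r, c) = b + eL + eU"
    unfolding eff_sensitivity_entry[OF rc] b_def eL_def eU_def by linarith
  have nonneg: "0 \<le> b" "0 \<le> L" "0 \<le> U" "0 \<le> eL" "0 \<le> eU"
    unfolding b_def L_def U_def eL_def eU_def chain_sensitivity_def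
    by (intro add_nonneg_nonneg sum_nonneg abs_ge_zero)+
  have upper: "L \<le> (real n - 1) * eL" "U \<le> (real n - 1) * eU"
    unfolding L_def U_def eL_def eU_def chain_sensitivity_def
    by (intro rotation_sums_le[OF assms(1)] givens_sin_sq_bounds)+
  have lower: "eL \<le> 3 * (real n - 2) * L" "eU \<le> 3 * (real n - 2) * U"
    unfolding L_def U_def eL_def eU_def chain_sensitivity_def
    by (intro row_sums_le[OF assms(1)] givens_sin_sq_bounds)+
  have b: "b \<le> (real n - 1) * b" "b \<le> 3 * (real n - 2) * b"
    using assms(1) nonneg(1) mult_right_mono[of 1 "real n - 1" b] mult_right_mono[of 1 "3 * (real n - 2)" b] by auto
  show "sensitivity $$ (r, c) \<le> (real n - 1) * eff_sensitivity $$ (r, c)"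
    unfolding s e distrib_left using b upper by linarith
  show "eff_sensitivity $$ (r, c) \<le> 3 * (real n - 2) * sensitivity $$ (r, c)"
    unfolding s e distrib_left using b lower by linarith
  show "0 \<le> sensitivity $$ (r, c)" "0 \<le> eff_sensitivity $$ (r, c)"
    unfolding s e using nonneg by linarith+
qed

lemma max_norm_sensitivity_le:
  assumes "3 \<le> n"
  shows "max_norm sensitivity \<le> (real n - 1) * max_norm eff_sensitivity"
    and "max_norm eff_sensitivity \<le> 3 * (real n - 2) * max_norm sensitivity"
proof -
  note le = sensitivity_le[OF assms]
  have pos: "0 \<le> real n - 1" "0 \<le> 3 * (real n - 2)" using assms by simp_all
  show "max_norm sensitivity \<le> (real n - 1) * max_norm eff_sensitivity"
  proof (rule max_norm_le[OF sensitivity_carrier n m])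
    fix r c assume rc: "r < n" "c < m"
    have "(real n - 1) * eff_sensitivity $$ (r, c) \<le> (real n - 1) * max_norm eff_sensitivity"
      using abs_entry_le_max_norm[OF eff_sensitivity_carrier rc] pos(1) by (intro mult_left_mono) simp_all
    then show "\<bar>sensitivity $$ (r, c)\<bar> \<le> (real n - 1) * max_norm eff_sensitivity"
      using le(1,3)[OF rc] by linarith
  qed
  show "max_norm eff_sensitivity \<le> 3 * (real n - 2) * max_norm sensitivity"
  proof (rule max_norm_le[OF eff_sensitivity_carrier n m])
    fix r c assume rc: "r < n" "c < m"
    have "3 * (real n - 2) * sensitivity $$ (r, c) \<le> 3 * (real n - 2) * max_norm sensitivity"
      using abs_entry_le_max_norm[OF sensitivity_carrier rc] pos(2) by (intro mult_left_mono) simp_all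
    then show "\<bar>eff_sensitivity $$ (r, c)\<bar> \<le> 3 * (real n - 2) * max_norm sensitivity"
      using le(2,4)[OF rc] by linarith
  qed
qed

end

theorem theorem5p3:
  fixes n m M :: nat
    and A X :: "real mat"
    and S :: "nat \<Rightarrow> real mat"
    and \<omega> :: "nat \<Rightarrow> real"
    and \<Omega>\<^sub>G\<^sub>V :: gv_params
    and \<Omega>\<^sub>Q\<^sub>S :: qs_params
  assumes "n \<ge> 3" and "m \<ge> 1"
    and "A \<in> carrier_mat n n" and "invertible_mat A"
    and "quasiseparable 1 1 n A"
    and "A = gv_mat n \<Omega>\<^sub>G\<^sub>V"
    and "A = qs_mat n \<Omega>\<^sub>Q\<^sub>S"
    and "\<forall>k\<in>{1..M}. S k \<in> carrier_mat n m"
    and "X \<in> carrier_mat n m"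
    and "A * X = sparse_mat n m M S \<omega>"
    and "\<forall>i<n. \<forall>j<m. X $$ (i, j) \<noteq> 0"
  shows "(gv_growth n m M S \<Omega>\<^sub>G\<^sub>V \<omega> X \<longlongrightarrow> gv_cond n m M S \<Omega>\<^sub>G\<^sub>V \<omega> X) (at_right 0)
    \<and> ereal (eff_cond n m M S (qs_mat n \<Omega>\<^sub>Q\<^sub>S) \<omega> X / (3 * (real n - 2))) \<le> gv_cond n m M S \<Omega>\<^sub>G\<^sub>V \<omega> X
    \<and> gv_cond n m M S \<Omega>\<^sub>G\<^sub>V \<omega> X \<le> ereal ((real n - 1) * eff_cond n m M S (qs_mat n \<Omega>\<^sub>Q\<^sub>S) \<omega> X)"
proof -
  have nm: "0 < n" "0 < m" using assms(1,2) by auto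
  have "0 < \<bar>X $$ (0, 0)\<bar>" using assms(11) nm by simp
  also have "\<dots> \<le> max_norm X" by (rule abs_entry_le_max_norm[OF assms(9) nm])
  finally have X0: "0 < max_norm X" .
  interpret gv_system n m M S \<Omega>\<^sub>G\<^sub>V \<omega> X "inv_mat A"
    using nm X0 assms(6,8,9,10) inv_mat_correct[OF assms(3,4)] by unfold_locales auto
  have eff: "eff_cond n m M S (qs_mat n \<Omega>\<^sub>Q\<^sub>S) \<omega> X = max_norm eff_sensitivity / max_norm X"
    unfolding eff_cond_def eff_sensitivity_def Let_def assms(7)[symmetric] assms(6)[symmetric] by simp
  have pos: "0 < 3 * (real n - 2)" using assms(1) by simp
  have "max_norm eff_sensitivity / (3 * (real n - 2)) \<le> max_norm sensitivity"
    using max_norm_sensitivity_le(2)[OF assms(1)] unfolding pos_divide_le_eq[OF pos] by (simp only: mult.commute)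
  from divide_right_mono[OF this less_imp_le[OF X_pos]]
  have pos: "0 < 3 * (real n - 2)" using assms(1) by simp
  have "max_norm eff_sensitivity / (3 * (real n - 2)) \<le> max_norm sensitivity"
    using max_norm_sensitivity_le(2)[OF assms(1)] unfolding pos_divide_le_eq[OF pos] by (simp only: mult.commute)
  from divide_right_mono[OF this less_imp_le[OF X_pos]]
  have pos: "0 < 3 * (real n - 2)" using assms(1) by simp
  have "max_norm eff_sensitivity / (3 * (real n - 2)) \<le> max_norm sensitivity"
    using max_norm_sensitivity_le(2)[OF assms(1)] unfolding pos_divide_le_eq[OF pos] by (simp only: mult.commute)
  from divide_right_mono[OF this less_imp_le[OF X_pos]]
  have "max_norm eff_sensitivity / max_norm X / (3 * (real n - 2)) \<le> max_norm sensitivity / max_norm X"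
    by (simp only: divide_divide_eq_left mult.commute)
  moreover have "max_norm sensitivity / max_norm X \<le> (real n - 1) * (max_norm eff_sensitivity / max_norm X)"
    using divide_right_mono[OF max_norm_sensitivity_le(1)[OF assms(1)], of "max_norm X"] X_pos by simp
  ultimately show ?thesis
    unfolding eff gv_cond_eq using growth_tendsto by simp
qed

end
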